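(* Let $G$ be a finite non-abelian group such that $Z(G)$ is cyclic and $G$ is an $m$-centralizer group, where $m=|G|/|Z(G)|$. Then: (1) $G=A\times P$, where $A\cong\mathbb{Z}_t$ with $t$ odd, and $P$ is a $2$-group with cyclic center which has one of the following central decompositions: $Q(n,0)\,Q(1,1)^{\epsilon}$ where $\epsilon\geq 1$, $n>1$; or $Q(n,1)\,Q(1,1)^{\epsilon}$ where $\epsilon\geq 0$, $n>2$; or $Q(1,1)^{\epsilon}$ where $\epsilon\geq 1$; or $R(1)\,Q(1,1)^{\epsilon}$ where $\epsilon\geq 0$. (2) If in addition $G$ is a $\mathrm{CA}$-group, then $G=A\times P$, where $A\cong\mathbb{Z}_t$ with $t$ odd, and $P$ is a $2$-group with cyclic center which has one of the following central decompositions: $Q(n,0)\,Q(1,1)$ with $n>1$; or $Q(n,1)$ with $n>2$; or $Q(1,1)$; or $R(1)$.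
   Context: All groups are finite. $Z(G)$ is the center of $G$, $C_G(x)$ is the centralizer of $x$ in $G$, and $\mathrm{Cent}(G)=\{C_G(x): x\in G\}$. A group $G$ is called $n$-centralizer if $|\mathrm{Cent}(G)|=n$. A non-abelian group $G$ is called a $\mathrm{CA}$-group if $C_G(x)$ is abelian for all $x\in G\setminus Z(G)$. With $[u,v]=u^{-1}v^{-1}uv$ and $[u,v,w]=[[u,v],w]$, the following $2$-groups are defined by presentations: for $2r\le n$, $Q(n,r)=\langle a,b : a^{2^{n}}=b^{2^{r}}=1,\ a^{2^{n-r}}=[a,b]\rangle$ (in particular $Q(n,0)$ is the cyclic group of order $2^n$, $n>0$); for $r\le n<2r$, $Q(n,r)=\langle a,b : a^{2^{n}}=b^{2^{r}}=1,\ a^{2^{r}}=[a,b]^{2^{2r-n}},\ [a,b,a]=[a,b,b]=1\rangle$; for $n\ge 1$, $R(n)=\langle a,b : a^{2^{n+1}}=b^{2^{n+1}}=1,\ a^{2^{n}}=[a,b]^{2^{n-1}}=b^{2^{n}},\ [a,b,a]=[a,b,b]=1\rangle$. A group $P$ with cyclic center has the central decomposition $H_1H_2\cdots H_k$ if $P$ is the product of subgroups isomorphic to $H_1,\dots,H_k$ respectively which pairwise commute elementwise (an internal central product). The notation $Q(1,1)^{\epsilon}$ means $\epsilon$ factors, each isomorphic to $Q(1,1)$ (no such factor if $\epsilon=0$). *)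

theory Defs
  imports "HOL-Algebra.Algebra"
begin

definition center :: "('a, 'b) monoid_scheme \<Rightarrow> 'a set" where
  "center G = {z \<in> carrier G. \<forall>g \<in> carrier G. z \<otimes>\<^bsub>G\<^esub> g = g \<otimes>\<^bsub>G\<^esub> z}"

definition centralizer :: "('a, 'b) monoid_scheme \<Rightarrow> 'a \<Rightarrow> 'a set" where
  "centralizer G x = {g \<in> carrier G. g \<otimes>\<^bsub>G\<^esub> x = x \<otimes>\<^bsub>G\<^esub> g}"

definition Cent :: "('a, 'b) monoid_scheme \<Rightarrow> 'a set set" where
  "Cent G = centralizer G ` carrier G"

definition n_centralizer :: "nat \<Rightarrow> ('a, 'b) monoid_scheme \<Rightarrow> bool" where
  "n_centralizer n G \<longleftrightarrow> card (Cent G) = n"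

definition CA_group :: "('a, 'b) monoid_scheme \<Rightarrow> bool" where
  "CA_group G \<longleftrightarrow> group G \<and> \<not> comm_group G \<and>
     (\<forall>x \<in> carrier G - center G. comm_group (G\<lparr>carrier := centralizer G x\<rparr>))"

text \<open>
  A word over the generators \<open>'x\<close> is a list of letters; \<open>(True, x)\<close> stands for \<open>x\<close> and
  \<open>(False, x)\<close> for \<open>x\<inverse>\<close>. A relation \<open>u = v\<close> is the pair of words \<open>(u, v)\<close>.
\<close>

type_synonym 'x word = "(bool \<times> 'x) list"

definition gen :: "'x \<Rightarrow> 'x word" where
  "gen x = [(True, x)]"

definition winv :: "'x word \<Rightarrow> 'x word" where
  "winv w = rev (map (\<lambda>(e, x). (\<not> e, x)) w)"

definition wpow :: "'x word \<Rightarrow> nat \<Rightarrow> 'x word" where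
  "wpow w n = concat (replicate n w)"

definition wcomm :: "'x word \<Rightarrow> 'x word \<Rightarrow> 'x word" where
  "wcomm u v = winv u @ winv v @ u @ v"

inductive word_eq :: "('x word \<times> 'x word) set \<Rightarrow> 'x word \<Rightarrow> 'x word \<Rightarrow> bool"
  for R where
  relation: "(u, v) \<in> R \<Longrightarrow> word_eq R u v"
| cancel: "word_eq R [(e, x), (\<not> e, x)] []"
| refl: "word_eq R w w"
| sym: "word_eq R u v \<Longrightarrow> word_eq R v u"
| trans: "word_eq R u v \<Longrightarrow> word_eq R v w \<Longrightarrow> word_eq R u w"
| append: "word_eq R u u' \<Longrightarrow> word_eq R v v' \<Longrightarrow> word_eq R (u @ v) (u' @ v')"

definition word_rel :: "('x word \<times> 'x word) set \<Rightarrow> ('x word \<times> 'x word) set" where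
  "word_rel R = {(u, v). word_eq R u v}"

definition presented_group :: "('x word \<times> 'x word) set \<Rightarrow> 'x word set monoid" where
  "presented_group R =
     \<lparr>carrier = UNIV // word_rel R,
      monoid.mult = (\<lambda>U V. word_rel R `` {u @ v | u v. u \<in> U \<and> v \<in> V}),
      one = word_rel R `` {[]}\<rparr>"

lemma equiv_word_rel: "equiv UNIV (word_rel R)"
  by (intro equivI refl_onI symI transI)
     (auto simp: word_rel_def intro: word_eq.intros)

lemma word_rel_class_eq_iff: "word_rel R `` {u} = word_rel R `` {v} \<longleftrightarrow> word_eq R u v"
  using eq_equiv_class_iff[OF equiv_word_rel, of u v R] by (simp add: word_rel_def)

lemma presented_group_mult:
  "word_rel R `` {u} \<otimes>\<^bsub>presented_group R\<^esub> word_rel R `` {v} = word_rel R `` {u @ v}"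
proof (rule Set.set_eqI)
  fix w
  have "word_eq R (u @ v) w" if "word_eq R u u'" "word_eq R v v'" "word_eq R (u' @ v') w" for u' v'
    using that by (blast intro: word_eq.append word_eq.trans)
  then show "w \<in> word_rel R `` {u} \<otimes>\<^bsub>presented_group R\<^esub> word_rel R `` {v}
      \<longleftrightarrow> w \<in> word_rel R `` {u @ v}"
    by (auto simp: presented_group_def word_rel_def intro: word_eq.refl)
qed

lemma word_eq_winv: "word_eq R (winv w @ w) []"
proof (induction w)
  case Nil
  show ?case by (simp add: winv_def word_eq.refl)
next
  case (Cons l w)
  obtain e x where l: "l = (e, x)" by (cases l)
  have "word_eq R ([(\<not> e, x), (e, x)] @ w) ([] @ w)"
    using word_eq.cancel[of R "\<not> e" x] by (intro word_eq.append word_eq.refl) simp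
  then have "word_eq R (winv w @ ([(\<not> e, x), (e, x)] @ w)) (winv w @ w)"
    by (intro word_eq.append word_eq.refl) simp
  then show ?case
    using Cons.IH by (simp add: winv_def l) (blast intro: word_eq.trans)
qed

lemma presented_group_one: "\<one>\<^bsub>presented_group R\<^esub> = word_rel R `` {[]}"
  by (simp add: presented_group_def)

lemma presented_group_carrier: "carrier (presented_group R) = range (\<lambda>u. word_rel R `` {u})"
  by (auto simp: presented_group_def quotient_def)

lemma group_presented_group: "group (presented_group R)"
proof (rule groupI)
  fix U assume "U \<in> carrier (presented_group R)"
  then obtain u where u: "U = word_rel R `` {u}"
    by (auto simp: presented_group_carrier)
  have "word_rel R `` {winv u} \<otimes>\<^bsub>presented_group R\<^esub> U = \<one>\<^bsub>presented_group R\<^esub>"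
    by (simp add: u presented_group_mult presented_group_one word_rel_class_eq_iff word_eq_winv)
  then show "\<exists>V \<in> carrier (presented_group R).
      V \<otimes>\<^bsub>presented_group R\<^esub> U = \<one>\<^bsub>presented_group R\<^esub>"
    by (auto simp: presented_group_carrier)
qed (auto simp: presented_group_carrier presented_group_one presented_group_mult)

fun word_value :: "('g, 'b) monoid_scheme \<Rightarrow> ('x \<Rightarrow> 'g) \<Rightarrow> 'x word \<Rightarrow> 'g" where
  "word_value K f [] = \<one>\<^bsub>K\<^esub>"
| "word_value K f ((e, x) # w) =
     (if e then f x else inv\<^bsub>K\<^esub> (f x)) \<otimes>\<^bsub>K\<^esub> word_value K f w"

lemma presented_group_von_Dyck:
  assumes "group K" and f: "\<And>x. f x \<in> carrier K"
    and R: "\<And>u v. (u, v) \<in> R \<Longrightarrow> word_value K f u = word_value K f v"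
  shows "\<exists>h \<in> hom (presented_group R) K. \<forall>w. h (word_rel R `` {w}) = word_value K f w"
proof -
  interpret K: group K by fact
  have closed: "word_value K f w \<in> carrier K" for w
    by (induction w) (auto simp: f)
  have app: "word_value K f (u @ v) = word_value K f u \<otimes>\<^bsub>K\<^esub> word_value K f v" for u v
    by (induction u) (auto simp: f closed K.m_assoc)
  have eq: "word_value K f u = word_value K f v" if "word_eq R u v" for u v
    using that by induction (auto simp: R f app)
  define h where "h U = word_value K f (SOME w. w \<in> U)" for U
  have h: "h (word_rel R `` {w}) = word_value K f w" for w
  proof -
    have "w \<in> word_rel R `` {w}" by (simp add: word_rel_def word_eq.refl)
    then have "(SOME v. v \<in> word_rel R `` {w}) \<in> word_rel R `` {w}" by (rule someI)
    then show ?thesis using eq by (auto simp: h_def word_rel_def)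
  qed
  have "h \<in> hom (presented_group R) K"
    by (auto simp: hom_def presented_group_carrier presented_group_mult h closed app)
  with h show ?thesis by blast
qed

datatype ab = Gen_a | Gen_b

abbreviation wa :: "ab word" where "wa \<equiv> gen Gen_a"
abbreviation wb :: "ab word" where "wb \<equiv> gen Gen_b"

text \<open>\<open>Q(n,r)\<close> is only meaningful for \<open>r \<le> n\<close>, and \<open>R(n)\<close> for \<open>1 \<le> n\<close>.\<close>

definition Q_group :: "nat \<Rightarrow> nat \<Rightarrow> ab word set monoid" where
  "Q_group n r = presented_group
     (if 2 * r \<le> n then
        {(wpow wa (2 ^ n), []), (wpow wb (2 ^ r), []),
         (wpow wa (2 ^ (n - r)), wcomm wa wb)}
      else
        {(wpow wa (2 ^ n), []), (wpow wb (2 ^ r), []),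
         (wpow wa (2 ^ r), wpow (wcomm wa wb) (2 ^ (2 * r - n))),
         (wcomm (wcomm wa wb) wa, []), (wcomm (wcomm wa wb) wb, [])})"

definition R_group :: "nat \<Rightarrow> ab word set monoid" where
  "R_group n = presented_group
     {(wpow wa (2 ^ (n + 1)), []), (wpow wb (2 ^ (n + 1)), []),
      (wpow wa (2 ^ n), wpow (wcomm wa wb) (2 ^ (n - 1))),
      (wpow (wcomm wa wb) (2 ^ (n - 1)), wpow wb (2 ^ n)),
      (wcomm (wcomm wa wb) wa, []), (wcomm (wcomm wa wb) wb, [])}"

definition internal_direct_product :: "('a, 'b) monoid_scheme \<Rightarrow> 'a set \<Rightarrow> 'a set \<Rightarrow> bool" where
  "internal_direct_product G A B \<longleftrightarrow>
     A \<lhd> G \<and> B \<lhd> G \<and> A \<inter> B = {\<one>\<^bsub>G\<^esub>} \<and> A <#>\<^bsub>G\<^esub> B = carrier G"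

definition two_group :: "('a, 'b) monoid_scheme \<Rightarrow> bool" where
  "two_group P \<longleftrightarrow> group P \<and> (\<exists>k. order P = 2 ^ k)"

definition cyclic_center :: "('a, 'b) monoid_scheme \<Rightarrow> bool" where
  "cyclic_center P \<longleftrightarrow> cyclic_group (P\<lparr>carrier := center P\<rparr>)"

text \<open>
  The factors \<open>Ks\<close> correspond to the list \<open>Hs\<close> position by position, so that a group occurring
  \<open>\<epsilon>\<close> times in \<open>Hs\<close> contributes \<open>\<epsilon>\<close> factors.
\<close>

definition central_decomposition :: "('a, 'b) monoid_scheme \<Rightarrow> 'h monoid list \<Rightarrow> bool" where
  "central_decomposition P Hs \<longleftrightarrow>
     (\<exists>Ks. list_all2 (\<lambda>K H. subgroup K P \<and> P\<lparr>carrier := K\<rparr> \<cong> H) Ks Hs \<and>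
           (\<forall>i < length Ks. \<forall>j < length Ks. i \<noteq> j \<longrightarrow>
              (\<forall>x \<in> Ks ! i. \<forall>y \<in> Ks ! j. x \<otimes>\<^bsub>P\<^esub> y = y \<otimes>\<^bsub>P\<^esub> x)) \<and>
           carrier P = foldr (\<lambda>K L. K <#>\<^bsub>P\<^esub> L) Ks {\<one>\<^bsub>P\<^esub>})"

end

(*
  Elements of the same coset of Z = Z(G) have the same centralizer, so if there are |G/Z| distinct
  centralizers then C(x) = C(y) holds only for xZ = yZ. As x and its inverse have the same
  centralizer, all squares are central; hence all commutators are central of order at most two.
  Since Z is cyclic they lie in {1, c}, where c is the involution of Z. Raising to the power
  2^(k+1), with 2^k the 2-part of |Z|, is a homomorphism whose kernel P is the 2-part of G, and
  the odd part A of Z complements it.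

  On P the commutator is a nondegenerate alternating form on P/Z(P), and noncommuting involutions
  generate a dihedral group Q(1,1) that splits off, its centralizer being the complementary central
  factor. For k = 1 this can be continued until the center or a quaternion group R(1) remains. For
  k > 1, squaring induces a linear functional from P/Z(P) to Z(P) modulo squares. If it vanishes,
  every coset of the center contains an involution and only the center Q(k,0) remains. Otherwise it
  is represented by an involution b, which together with an element w outside its kernel generates
  Q(k+1,1), and the functional vanishes on the centralizer of w and b. In a CA-group the
  centralizer of a noncommuting pair is central, so there is only one nonabelian factor.
*)

theory Submission
  imports Defs
begin

subsection \<open>Words in two generators\<close>

text \<open>Identifying a subgroup with a presented group takes more than checking relations: von
  Dyck's map onto the subgroup must also be injective. No order of a presented group is computed for
  this. The relations reduce every word to one of 1, a, b, ab times a power of a single word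
  \<open>D\<close>. If the value of the word is trivial, the factor in front of the power of
  \<open>D\<close> commutes with both generators, and since these do not commute it is 1. (The
  cyclic case counts exponents instead.)

  The separation of k = 1 from k > 1 comes from the rule that (xy)^2 is x^2 y^2 or x^2 y^2 c. The
  involution c = z^(2^(k-1)) is a square in the center exactly when k > 1. Modulo squares of the
  center, squaring is therefore additive for k > 1 but only quadratic for k = 1. A quadratic form
  may leave an anisotropic plane, and this is the origin of the quaternion group R(1).

  The relation w^(2^k) = c = [w,b] of Q(k+1,1) holds because w^2 is an odd power of z. For the same
  reason this factor contains the whole center, so no separate cyclic factor is left over.\<close>

context group
begin

lemma word_value_closed:
  assumes "\<And>x. f x \<in> carrier G"
  shows "word_value G f w \<in> carrier G"
  by (induction w) (auto simp: assms)

lemma word_value_append: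
  assumes "\<And>x. f x \<in> carrier G"
  shows "word_value G f (u @ v) = word_value G f u \<otimes> word_value G f v"
  by (induction u) (auto simp: assms word_value_closed m_assoc)

lemma word_value_winv:
  assumes f: "\<And>x. f x \<in> carrier G"
  shows "word_value G f (winv w) = inv (word_value G f w)"
proof (induction w)
  case (Cons l w)
  obtain e x where l: "l = (e, x)" by (cases l)
  have "winv (l # w) = winv w @ [(\<not> e, x)]"
    by (simp add: winv_def l)
  then show ?case
    by (simp add: l word_value_append f Cons inv_mult_group word_value_closed)
qed (simp add: winv_def)

lemma word_value_wpow:
  assumes f: "\<And>x. f x \<in> carrier G"
  shows "word_value G f (wpow w n) = word_value G f w [^] n"
proof (induction n)
  case (Suc n)
  then show ?case
    using nat_pow_Suc2[OF word_value_closed, of f w n] f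
    by (simp add: wpow_def word_value_append f)
qed (simp add: wpow_def)

lemma word_value_gen:
  assumes "\<And>x. f x \<in> carrier G"
  shows "word_value G f (gen x) = f x"
  by (simp add: gen_def assms)

lemma word_value_wcomm:
  assumes f: "\<And>x. f x \<in> carrier G"
  shows "word_value G f (wcomm u v) =
    inv (word_value G f u) \<otimes> (inv (word_value G f v) \<otimes> (word_value G f u \<otimes> word_value G f v))"
  by (simp add: wcomm_def word_value_append word_value_winv f)

lemmas word_value_simps =
  word_value_append word_value_winv word_value_wpow word_value_gen word_value_wcomm

lemma word_value_in_subgroup:
  assumes "subgroup H G" and "\<And>x. f x \<in> H"
  shows "word_value G f w \<in> H"
  using assms(2) subgroup.one_closed[OF assms(1)] subgroup.m_closed[OF assms(1)]
    subgroup.m_inv_closed[OF assms(1)]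
  by (induction w) auto

lemma subgroup_range_word_value:
  assumes f: "\<And>x. f x \<in> carrier G"
  shows "subgroup (range (word_value G f)) G"
proof (rule subgroupI)
  show "range (word_value G f) \<subseteq> carrier G"
    using word_value_closed[OF f] by auto
  show "inv a \<in> range (word_value G f)" if "a \<in> range (word_value G f)" for a
    using that by (auto simp: word_value_winv[OF f, symmetric])
  show "a \<otimes> b \<in> range (word_value G f)"
    if "a \<in> range (word_value G f)" "b \<in> range (word_value G f)" for a b
    using that by (auto simp: word_value_append[OF f, symmetric])
qed auto

lemma commutes_inv:
  assumes "x \<in> carrier G" "y \<in> carrier G" "x \<otimes> y = y \<otimes> x"
  shows "inv x \<otimes> y = y \<otimes> inv x"
  using assms by (metis inv_closed inv_solve_left inv_solve_right m_assoc m_closed)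

text \<open>The set of such forms is closed under left multiplication by d, a and b: d commutes with
  both letters, squares of letters are powers of d, and b passes a at the cost of a power of d.
  Inverse letters need no rules of their own, since a^-1 = a (a^2)^-1 is again a times a power of d,
  and likewise for b.\<close>

lemma word_value_normal_form:
  fixes N p q r :: nat
  assumes c: "a \<in> carrier G" "b \<in> carrier G" "d \<in> carrier G"
    and d: "d \<otimes> a = a \<otimes> d" "d \<otimes> b = b \<otimes> d" "d [^] N = \<one>" "N > 0"
    and rel: "a \<otimes> a = d [^] p" "b \<otimes> b = d [^] q" "b \<otimes> a = a \<otimes> b \<otimes> d [^] r"
    and f: "f Gen_a = a" "f Gen_b = b"
  shows "\<exists>e \<in> {\<one>, a}. \<exists>s \<in> {\<one>, b}. \<exists>i::nat. word_value G f w = e \<otimes> s \<otimes> d [^] i"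
proof -
  define form where
    "form u \<longleftrightarrow> (\<exists>e \<in> {\<one>, a}. \<exists>s \<in> {\<one>, b}. \<exists>i::nat. u = e \<otimes> s \<otimes> d [^] i)" for u
  have formI: "form (e \<otimes> s \<otimes> d [^] i)" if "e \<in> {\<one>, a}" "s \<in> {\<one>, b}" for e s and i :: nat
    using that unfolding form_def by blast
  have formE: thesis
    if "form u" "\<And>e s i::nat. e \<in> {\<one>, a} \<Longrightarrow> s \<in> {\<one>, b} \<Longrightarrow> e \<in> carrier G \<Longrightarrow> s \<in> carrier G
        \<Longrightarrow> u = e \<otimes> s \<otimes> d [^] i \<Longrightarrow> thesis" for u thesis
    using that c unfolding form_def by blast
  have dp: "d [^] i \<in> carrier G" for i :: nat
    using c by simp
  have da: "d [^] i \<otimes> a = a \<otimes> d [^] i" and db: "d [^] i \<otimes> b = b \<otimes> d [^] i" for i :: nat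
    using c d(1,2) by (simp_all add: group_commutes_pow)
  have dd: "d [^] i \<otimes> d [^] j = d [^] (i + j)" for i j :: nat
    using c by (simp add: nat_pow_mult)
  \<comment> \<open>From d^N = 1 with N positive, d^(i(N-1)) inverts d^i, so exponents stay natural
    numbers.\<close>
  have inv_dp: "\<exists>j::nat. inv (d [^] i) = d [^] j" for i :: nat
  proof -
    have "d [^] i \<otimes> d [^] (i * (N - 1)) = d [^] (N * i)"
      using \<open>N > 0\<close> by (cases N) (simp_all add: dd mult.commute)
    also have "\<dots> = \<one>" using c d(3) by (simp add: nat_pow_pow[symmetric])
    finally have "inv (d [^] i) = d [^] (i * (N - 1))"
      using c by (metis dp inv_equality inv_comm)
    then show ?thesis by blast
  qed
  have inv_a: "\<exists>j::nat. inv a = a \<otimes> d [^] j"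
  proof -
    have "inv a = a \<otimes> inv (a \<otimes> a)" using c by (simp add: inv_mult_group m_assoc[symmetric])
    then show ?thesis using inv_dp[of p] rel by auto
  qed
  have inv_b: "\<exists>j::nat. inv b = b \<otimes> d [^] j"
  proof -
    have "inv b = b \<otimes> inv (b \<otimes> b)" using c by (simp add: inv_mult_group m_assoc[symmetric])
    then show ?thesis using inv_dp[of q] rel by auto
  qed
  have fd: "form (d [^] j \<otimes> u)" if "form u" for u and j :: nat
    using that
  proof (rule formE)
    fix e s and i :: nat
    assume *: "e \<in> {\<one>, a}" "s \<in> {\<one>, b}" "e \<in> carrier G" "s \<in> carrier G" "u = e \<otimes> s \<otimes> d [^] i"
    have 1: "d [^] j \<otimes> e = e \<otimes> d [^] j" "d [^] j \<otimes> s = s \<otimes> d [^] j"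
      using *(1,2) da db c by auto
    have "d [^] j \<otimes> u = e \<otimes> s \<otimes> (d [^] j \<otimes> d [^] i)"
      using *(3,4,5) dp 1 by (metis m_assoc m_closed)
    then show ?thesis using formI[OF *(1,2)] by (simp add: dd)
  qed
  have fa: "form (a \<otimes> u)" if "form u" for u
    using that
  proof (rule formE)
    fix e s and i :: nat
    assume *: "e \<in> {\<one>, a}" "s \<in> {\<one>, b}" "e \<in> carrier G" "s \<in> carrier G" "u = e \<otimes> s \<otimes> d [^] i"
    show ?thesis
    proof (cases "e = a")
      case True
      have "a \<otimes> u = d [^] p \<otimes> (\<one> \<otimes> s \<otimes> d [^] i)"
        using *(4,5) True c by (simp add: m_assoc flip: rel(1))
      then show ?thesis using fd formI *(2) by simp
    next
      case False
      then have "a \<otimes> u = a \<otimes> s \<otimes> d [^] i"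
        using * c by (auto simp: m_assoc)
      then show ?thesis using formI *(2) by simp
    qed
  qed
  have fb: "form (b \<otimes> u)" if "form u" for u
    using that
  proof (rule formE)
    fix e s and i :: nat
    assume *: "e \<in> {\<one>, a}" "s \<in> {\<one>, b}" "e \<in> carrier G" "s \<in> carrier G" "u = e \<otimes> s \<otimes> d [^] i"
    have 1: "form (b \<otimes> (s \<otimes> d [^] i))"
    proof (cases "s = b")
      case True
      have "b \<otimes> (s \<otimes> d [^] i) = d [^] q \<otimes> (\<one> \<otimes> \<one> \<otimes> d [^] i)"
        using True c by (simp add: m_assoc flip: rel(2))
      then show ?thesis using fd[OF formI, of \<one> \<one> q i] by simp
    next
      case False
      then have "b \<otimes> (s \<otimes> d [^] i) = \<one> \<otimes> b \<otimes> d [^] i"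
        using *(2) c by simp
      then show ?thesis using formI by simp
    qed
    show ?thesis
    proof (cases "e = a")
      case True
      have "b \<otimes> u = (b \<otimes> a) \<otimes> (s \<otimes> d [^] i)"
        using *(4,5) True c by (simp add: m_assoc)
      also have "\<dots> = a \<otimes> ((b \<otimes> d [^] r) \<otimes> (s \<otimes> d [^] i))"
        using c *(4) by (simp add: rel(3) m_assoc)
      also have "\<dots> = a \<otimes> (d [^] r \<otimes> (b \<otimes> (s \<otimes> d [^] i)))"
        using c *(4) by (simp add: m_assoc flip: db)
      finally show ?thesis using fa fd 1 by simp
    next
      case False
      then show ?thesis using * 1 c by (simp add: m_assoc)
    qed
  qed
  have "form (word_value G f w)"
  proof (induction w)
    case Nil
    have "word_value G f [] = \<one> \<otimes> \<one> \<otimes> d [^] (0::nat)" by simp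
    then show ?case using formI by (metis insertI1)
  next
    case (Cons l w)
    obtain e x where l: "l = (e, x)" by (cases l)
    have w: "word_value G f w \<in> carrier G"
      using c f by (intro word_value_closed) (metis ab.exhaust)
    obtain i j :: nat where ij: "inv a = a \<otimes> d [^] i" "inv b = b \<otimes> d [^] j"
      using inv_a inv_b by blast
    have "form (a \<otimes> (d [^] i \<otimes> word_value G f w))" "form (b \<otimes> (d [^] j \<otimes> word_value G f w))"
      "form (a \<otimes> word_value G f w)" "form (b \<otimes> word_value G f w)"
      by (intro fa fb fd Cons)+
    then show ?case
      using w c ij by (cases x; cases e) (simp_all add: l f m_assoc)
  qed
  then show ?thesis by (simp only: form_def)
qed

end

section \<open>Homomorphisms from a presented group onto a generated subgroup\<close>

lemma word_value_presented_group:
  "word_value (presented_group R) (\<lambda>x. word_rel R `` {gen x}) w = word_rel R `` {w}"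
proof (induction w)
  case Nil
  show ?case by (simp add: presented_group_one)
next
  case (Cons l w)
  interpret group "presented_group R" by (rule group_presented_group)
  obtain e x where l: "l = (e, x)" by (cases l)
  have "inv\<^bsub>presented_group R\<^esub> (word_rel R `` {gen x}) = word_rel R `` {[(False, x)]}"
  proof (rule inv_equality)
    show "word_rel R `` {[(False, x)]} \<otimes>\<^bsub>presented_group R\<^esub> word_rel R `` {gen x}
        = \<one>\<^bsub>presented_group R\<^esub>"
      using word_eq.cancel[of R False x]
      by (simp add: presented_group_mult presented_group_one word_rel_class_eq_iff gen_def)
  qed (auto simp: presented_group_carrier)
  then show ?case
    by (cases e) (simp_all add: l Cons presented_group_mult, simp_all add: presented_group_mult gen_def)
qed

definition satisfies ::
    "('g, 'b) monoid_scheme \<Rightarrow> ('x \<Rightarrow> 'g) \<Rightarrow> ('x word \<times> 'x word) set \<Rightarrow> bool" where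
  "satisfies K f R \<longleftrightarrow> (\<forall>(u, v) \<in> R. word_value K f u = word_value K f v)"

lemma satisfiesD: "satisfies K f R \<Longrightarrow> (u, v) \<in> R \<Longrightarrow> word_value K f u = word_value K f v"
  by (auto simp: satisfies_def)

lemma presented_group_satisfies:
  "satisfies (presented_group R) (\<lambda>x. word_rel R `` {gen x}) R"
  by (auto simp: satisfies_def word_value_presented_group word_rel_class_eq_iff word_eq.relation)

lemma presented_group_hom:
  assumes "group K" and "\<And>x. f x \<in> carrier K" and "satisfies K f R"
  shows "\<exists>h \<in> hom (presented_group R) K. \<forall>w. h (word_rel R `` {w}) = word_value K f w"
  by (rule presented_group_von_Dyck[where f = f]) (use assms in \<open>auto simp: satisfies_def\<close>)

text \<open>
  Consequences of the defining relations of \<open>Q(1,1)\<close> and \<open>R(1)\<close>, with \<open>D = [a,b]\<close>, and of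
  \<open>Q(n,1)\<close>, with \<open>D = a\<^sup>2\<close>. They reduce every word to one of \<open>D\<^sup>i, a D\<^sup>i, b D\<^sup>i, a b D\<^sup>i\<close>.
\<close>

definition normal_relations ::
    "ab word \<Rightarrow> nat \<Rightarrow> nat \<Rightarrow> nat \<Rightarrow> nat \<Rightarrow> (ab word \<times> ab word) set" where
  "normal_relations D N p q r =
     {(D @ wa, wa @ D), (D @ wb, wb @ D), (wpow D N, []), (wa @ wa, wpow D p),
      (wb @ wb, wpow D q), (wb @ wa, wa @ wb @ wpow D r)}"

text \<open>Von Dyck's homomorphism sends the class of a word to its value, so it maps onto the
  subgroup generated by the \<open>f x\<close>. The hypothesis \<open>ker\<close> is its
  injectivity.\<close>

lemma presented_group_iso:
  assumes "group K" and f: "\<And>x. f x \<in> carrier K"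
    and R: "satisfies K f R"
    and ker: "\<And>w. word_value K f w = \<one>\<^bsub>K\<^esub> \<Longrightarrow>
      word_value (presented_group R) (\<lambda>x. word_rel R `` {gen x}) w = \<one>\<^bsub>presented_group R\<^esub>"
  shows "K\<lparr>carrier := range (word_value K f)\<rparr> \<cong> presented_group R"
proof -
  interpret K: group K by fact
  interpret U: group "presented_group R" by (rule group_presented_group)
  let ?L = "K\<lparr>carrier := range (word_value K f)\<rparr>"
  interpret L: group ?L
    by (rule K.subgroup_imp_group[OF K.subgroup_range_word_value[OF f]])
  obtain h where h: "h \<in> hom (presented_group R) K"
    and hw: "\<And>w. h (word_rel R `` {w}) = word_value K f w"
    using presented_group_hom[OF \<open>group K\<close> f R] by blast
  have hL: "h \<in> hom (presented_group R) ?L"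
    using h by (auto simp: hom_def presented_group_carrier hw)
  interpret h: group_hom "presented_group R" ?L h
    by (simp add: group_hom_def group_hom_axioms_def hL U.group_axioms L.group_axioms)
  have "inj_on h (carrier (presented_group R))"
    unfolding h.inj_on_one_iff
  proof (intro allI impI)
    fix U assume "U \<in> carrier (presented_group R)" "h U = \<one>\<^bsub>?L\<^esub>"
    moreover from this obtain w where "U = word_rel R `` {w}"
      by (auto simp: presented_group_carrier)
    ultimately show "U = \<one>\<^bsub>presented_group R\<^esub>"
      using ker[of w] by (simp add: hw word_value_presented_group)
  qed
  moreover have "h ` carrier (presented_group R) = carrier ?L"
    by (auto simp: presented_group_carrier hw image_image)
  ultimately have "h \<in> iso (presented_group R) ?L"
    using hL by (simp add: iso_def bij_betw_def)
  then have "presented_group R \<cong> ?L" by (auto simp: is_iso_def)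
  then show ?thesis by (rule U.iso_sym)
qed

text \<open>A word of trivial value has in the presented group the form e s \<delta>^i. Then the
  image of e s is the inverse of d^i and commutes with x = \<open>f Gen_a\<close> and y =
  \<open>f Gen_b\<close>; none of x, y, xy does so, hence e = s = 1. What remains is d^i = 1, and
  since d has order exactly N, the relation \<delta>^N = 1 finishes.\<close>

lemma two_generator_presented_group_iso:
  fixes R :: "(ab word \<times> ab word) set" and N p q r :: nat
  assumes "group K" and f: "\<And>x. f x \<in> carrier K"
    and nc: "f Gen_a \<otimes>\<^bsub>K\<^esub> f Gen_b \<noteq> f Gen_b \<otimes>\<^bsub>K\<^esub> f Gen_a"
    and R: "satisfies K f R" and d': "satisfies K f (normal_relations D N p q r)"
    and ord: "group.ord K (word_value K f D) = N" "N > 0"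
    and U: "satisfies (presented_group R) (\<lambda>x. word_rel R `` {gen x}) (normal_relations D N p q r)"
  shows "K\<lparr>carrier := range (word_value K f)\<rparr> \<cong> presented_group R"
proof (rule presented_group_iso[OF \<open>group K\<close> f R])
  interpret K: group K by fact
  interpret U: group "presented_group R" by (rule group_presented_group)
  let ?U = "presented_group R"
  define g where "g = (\<lambda>x. word_rel R `` {gen x})"
  define d where "d = word_value K f D"
  have dc: "d \<in> carrier K" by (simp add: d_def K.word_value_closed f)
  have gc: "g x \<in> carrier ?U" for x
    by (auto simp: g_def presented_group_carrier)
  have gw: "word_value ?U g w = word_rel R `` {w}" for w
    by (simp add: g_def word_value_presented_group)
  note gs = U.word_value_simps[of g, OF gc]
  define \<delta> where "\<delta> = word_value ?U g D"
  have \<delta>c: "\<delta> \<in> carrier ?U" by (simp add: \<delta>_def U.word_value_closed gc)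
  have eq: "word_value ?U g u = word_value ?U g v" if "(u, v) \<in> normal_relations D N p q r" for u v
    using satisfiesD[OF U that] by (simp add: g_def)
  have rels: "\<delta> \<otimes>\<^bsub>?U\<^esub> g Gen_a = g Gen_a \<otimes>\<^bsub>?U\<^esub> \<delta>" "\<delta> \<otimes>\<^bsub>?U\<^esub> g Gen_b = g Gen_b \<otimes>\<^bsub>?U\<^esub> \<delta>"
    "\<delta> [^]\<^bsub>?U\<^esub> N = \<one>\<^bsub>?U\<^esub>" "g Gen_a \<otimes>\<^bsub>?U\<^esub> g Gen_a = \<delta> [^]\<^bsub>?U\<^esub> p"
    "g Gen_b \<otimes>\<^bsub>?U\<^esub> g Gen_b = \<delta> [^]\<^bsub>?U\<^esub> q"
    "g Gen_b \<otimes>\<^bsub>?U\<^esub> g Gen_a = g Gen_a \<otimes>\<^bsub>?U\<^esub> g Gen_b \<otimes>\<^bsub>?U\<^esub> \<delta> [^]\<^bsub>?U\<^esub> r"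
    using eq[of "D @ wa" "wa @ D"] eq[of "D @ wb" "wb @ D"] eq[of "wpow D N" "[]"]
      eq[of "wa @ wa" "wpow D p"] eq[of "wb @ wb" "wpow D q"] eq[of "wb @ wa" "wa @ wb @ wpow D r"]
    by (simp_all only: normal_relations_def gs \<delta>_def[symmetric] insert_iff U.m_assoc gc \<delta>c
      U.nat_pow_closed simp_thms word_value.simps)
  have d: "d \<otimes>\<^bsub>K\<^esub> f Gen_a = f Gen_a \<otimes>\<^bsub>K\<^esub> d" "d \<otimes>\<^bsub>K\<^esub> f Gen_b = f Gen_b \<otimes>\<^bsub>K\<^esub> d"
    using d' by (auto simp: satisfies_def normal_relations_def K.word_value_simps f d_def)
  fix w assume w: "word_value K f w = \<one>\<^bsub>K\<^esub>"
  obtain h where h: "h \<in> hom ?U K" and hw: "\<And>w. h (word_rel R `` {w}) = word_value K f w"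
    using presented_group_hom[OF \<open>group K\<close> f R] by blast
  interpret h: group_hom ?U K h
    by (simp add: group_hom_def group_hom_axioms_def h U.group_axioms K.group_axioms)
  have hg: "h (g x) = f x" for x
    by (simp add: g_def hw K.word_value_gen f)
  have h\<delta>: "h \<delta> = d" by (simp add: \<delta>_def gw hw d_def)
  obtain e s and i :: nat where es: "e \<in> {\<one>\<^bsub>?U\<^esub>, g Gen_a}" "s \<in> {\<one>\<^bsub>?U\<^esub>, g Gen_b}"
    and eq: "word_value ?U g w = e \<otimes>\<^bsub>?U\<^esub> s \<otimes>\<^bsub>?U\<^esub> \<delta> [^]\<^bsub>?U\<^esub> i"
    using U.word_value_normal_form[OF gc gc \<delta>c rels(1-3) \<open>N > 0\<close> rels(4-6), of g w] by blast
  have esc: "e \<in> carrier ?U" "s \<in> carrier ?U" using es gc by auto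
  have "h (word_value ?U g w) = \<one>\<^bsub>K\<^esub>" by (simp add: gw hw w)
  then have one: "h e \<otimes>\<^bsub>K\<^esub> h s \<otimes>\<^bsub>K\<^esub> d [^]\<^bsub>K\<^esub> i = \<one>\<^bsub>K\<^esub>"
    by (simp add: eq esc \<delta>c h.hom_nat_pow h\<delta>)
  let ?x = "f Gen_a" and ?y = "f Gen_b"
  have comm: "d [^]\<^bsub>K\<^esub> i \<otimes>\<^bsub>K\<^esub> f z = f z \<otimes>\<^bsub>K\<^esub> d [^]\<^bsub>K\<^esub> i" for z
    by (intro K.group_commutes_pow dc f) (use d in \<open>cases z; simp add: d_def\<close>)
  have dic: "d [^]\<^bsub>K\<^esub> i \<in> carrier K" using dc by simp
  \<comment> \<open>This equals the image of e s; as the inverse of a power of d it commutes with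
    both generators.\<close>
  define c where "c = inv\<^bsub>K\<^esub> (d [^]\<^bsub>K\<^esub> i)"
  have cc: "c \<in> carrier K" using dc by (simp add: c_def)
  have c: "c \<otimes>\<^bsub>K\<^esub> f z = f z \<otimes>\<^bsub>K\<^esub> c" for z
    unfolding c_def by (rule K.commutes_inv[OF dic f comm])
  have hes: "h e \<otimes>\<^bsub>K\<^esub> h s = c"
    using K.inv_equality[OF one dic] esc by (simp add: c_def)
  have "e = \<one>\<^bsub>?U\<^esub> \<and> s = \<one>\<^bsub>?U\<^esub>"
  proof (rule ccontr)
    assume "\<not> ?thesis"
    then consider "e = g Gen_a" "s = \<one>\<^bsub>?U\<^esub>" | "e = \<one>\<^bsub>?U\<^esub>" "s = g Gen_b" | "e = g Gen_a" "s = g Gen_b"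
      using es by blast
    then show False
    proof cases
      case 1
      then have "c = ?x" using hes by (simp add: hg f)
      then show False using c[of Gen_b] nc by simp
    next
      case 2
      then have "c = ?y" using hes by (simp add: hg f)
      then show False using c[of Gen_a] nc by simp
    next
      case 3
      then have "c = ?x \<otimes>\<^bsub>K\<^esub> ?y" using hes by (simp add: hg f)
      then have "?x \<otimes>\<^bsub>K\<^esub> (?y \<otimes>\<^bsub>K\<^esub> ?x) = ?x \<otimes>\<^bsub>K\<^esub> (?x \<otimes>\<^bsub>K\<^esub> ?y)"
        using c[of Gen_a] f by (simp add: K.m_assoc)
      then show False using nc f by (simp add: K.l_cancel)
    qed
  qed
  then have "d [^]\<^bsub>K\<^esub> i = \<one>\<^bsub>K\<^esub>" using one dc by simp
  then have "N dvd i" using ord dc K.pow_eq_id d_def by auto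
  then have "\<delta> [^]\<^bsub>?U\<^esub> i = \<one>\<^bsub>?U\<^esub>"
    using rels(3) \<delta>c by (metis dvdE U.nat_pow_pow U.nat_pow_one)
  then show "word_value ?U (\<lambda>x. word_rel R `` {gen x}) w = \<one>\<^bsub>?U\<^esub>"
    using \<open>e = _ \<and> s = _\<close> eq by (simp add: g_def)
qed

subsection \<open>Recognizing the presented groups\<close>

context group
begin

lemma commutator_eq_iff:
  assumes "a \<in> carrier G" "b \<in> carrier G" "c \<in> carrier G"
  shows "inv a \<otimes> (inv b \<otimes> (a \<otimes> b)) = c \<longleftrightarrow> a \<otimes> b = b \<otimes> a \<otimes> c"
  using assms by (simp add: inv_solve_left' m_assoc)

lemma commutator_swap_involution:
  assumes "a \<in> carrier G" "b \<in> carrier G" "c \<in> carrier G" "c \<otimes> c = \<one>"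
    and "a \<otimes> b = b \<otimes> a \<otimes> c"
  shows "b \<otimes> a = a \<otimes> b \<otimes> c"
  using assms(1-4) by (simp add: assms(5)) (simp add: m_assoc)

lemma pow_two: "a \<in> carrier G \<Longrightarrow> a [^] (2::nat) = a \<otimes> a"
  by (simp add: numeral_2_eq_2)

text \<open>With [a,b] central and of square one, swapping the generators costs [a,b] itself in
  either direction, whence N = 2 and r = 1.\<close>

lemma commutator_involution_normal_relations:
  fixes p q :: nat
  assumes f: "\<And>x. f x \<in> carrier G"
    and r: "satisfies G f {(wpow (wcomm wa wb) 2, []), (wcomm (wcomm wa wb) wa, []),
      (wcomm (wcomm wa wb) wb, []), (wa @ wa, wpow (wcomm wa wb) p), (wb @ wb, wpow (wcomm wa wb) q)}"
  shows "satisfies G f (normal_relations (wcomm wa wb) 2 p q 1)"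
proof -
  define c where "c = word_value G f (wcomm wa wb)"
  have c: "c \<in> carrier G" by (simp add: c_def word_value_closed f)
  have w: "inv (f Gen_a) \<otimes> (inv (f Gen_b) \<otimes> (f Gen_a \<otimes> f Gen_b)) = c"
    by (simp add: c_def word_value_simps f)
  note D = satisfiesD[OF r]
  have cc: "c \<otimes> c = \<one>"
    using D[of "wpow (wcomm wa wb) 2" "[]"] by (simp add: word_value_simps f w c pow_two)
  have ca: "c \<otimes> f Gen_a = f Gen_a \<otimes> c"
    using D[of "wcomm (wcomm wa wb) wa" "[]"]
    by (simp add: word_value_simps f w c commutator_eq_iff)
  have cb: "c \<otimes> f Gen_b = f Gen_b \<otimes> c"
    using D[of "wcomm (wcomm wa wb) wb" "[]"]
    by (simp add: word_value_simps f w c commutator_eq_iff)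
  have aa: "f Gen_a \<otimes> f Gen_a = c [^] p"
    using D[of "wa @ wa" "wpow (wcomm wa wb) p"] by (simp add: word_value_simps f w)
  have bb: "f Gen_b \<otimes> f Gen_b = c [^] q"
    using D[of "wb @ wb" "wpow (wcomm wa wb) q"] by (simp add: word_value_simps f w)
  have "f Gen_a \<otimes> f Gen_b = f Gen_b \<otimes> f Gen_a \<otimes> c"
    using w by (simp add: commutator_eq_iff c f)
  from commutator_swap_involution[OF f f c cc this]
  have "f Gen_b \<otimes> f Gen_a = f Gen_a \<otimes> (f Gen_b \<otimes> c)" by (simp add: m_assoc f c)
  then show ?thesis
    by (simp add: satisfies_def normal_relations_def word_value_simps f w c ca cb cc aa bb pow_two)
qed

text \<open>The centrality of c = a^(2^(n-1)) = [a,b] is not among the relations. It commutes with a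
  as a power of a, and with b because b^2 = 1. Hence b picks up c twice on passing a^2, so that a^2
  commutes with b. The parameters express everything in \<open>D\<close> = a^2: a^2 = D^1, b^2 = D^0
  and c = D^(2^(n-2)).\<close>

lemma modular_normal_relations:
  assumes f: "\<And>x. f x \<in> carrier G" and "n \<ge> 2"
    and r: "satisfies G f {(wpow wa (2 ^ n), []), (wpow wb 2, []),
      (wpow wa (2 ^ (n - 1)), wcomm wa wb)}"
  shows "satisfies G f (normal_relations (wpow wa 2) (2 ^ (n - 1)) 1 0 (2 ^ (n - 2)))"
proof -
  define a b c where "a = f Gen_a" and "b = f Gen_b" and "c = a [^] (2 ^ (n - 1) :: nat)"
  obtain m where n: "n = m + 2" using \<open>n \<ge> 2\<close> by (metis le_add_diff_inverse2)
  have cl: "a \<in> carrier G" "b \<in> carrier G" "c \<in> carrier G" by (simp_all add: a_def b_def c_def f)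
  note D = satisfiesD[OF r]
  have a: "a [^] (2 ^ n :: nat) = \<one>"
    using D[of "wpow wa (2 ^ n)" "[]"] by (simp add: word_value_simps f a_def)
  have bb: "b \<otimes> b = \<one>"
    using D[of "wpow wb 2" "[]"] by (simp add: word_value_simps f b_def pow_two)
  have ab: "a \<otimes> b = b \<otimes> a \<otimes> c"
    using D[of "wpow wa (2 ^ (n - 1))" "wcomm wa wb"] commutator_eq_iff[OF cl]
    by (simp add: word_value_simps f a_def b_def c_def)
  have cc: "c \<otimes> c = \<one>"
    using a by (simp add: c_def nat_pow_mult n cl flip: mult_2)
  have ca: "c \<otimes> a = a \<otimes> c"
    unfolding c_def using cl by (simp add: group_commutes_pow)
  have ba: "b \<otimes> a = a \<otimes> b \<otimes> c" using commutator_swap_involution[OF cl cc ab] .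
  \<comment> \<open>Both (ba)(cb) and (ba)(bc) collapse to a, by ab = bac and ba = abc
    respectively.\<close>
  have cb: "b \<otimes> c = c \<otimes> b"
  proof -
    have "(b \<otimes> a) \<otimes> (c \<otimes> b) = (b \<otimes> a \<otimes> c) \<otimes> b" using cl by (simp add: m_assoc)
    also have "\<dots> = a \<otimes> (b \<otimes> b)" unfolding ab[symmetric] using cl by (simp add: m_assoc)
    also have "\<dots> = a" using cl by (simp add: bb)
    finally have 1: "(b \<otimes> a) \<otimes> (c \<otimes> b) = a" .
    have "(b \<otimes> a) \<otimes> (b \<otimes> c) = b \<otimes> (a \<otimes> b \<otimes> c)" using cl by (simp add: m_assoc)
    also have "\<dots> = (b \<otimes> b) \<otimes> a" unfolding ba[symmetric] using cl by (simp add: m_assoc)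
    also have "\<dots> = a" using cl by (simp add: bb)
    finally have "(b \<otimes> a) \<otimes> (b \<otimes> c) = (b \<otimes> a) \<otimes> (c \<otimes> b)" using 1 by simp
    then show ?thesis using cl by simp
  qed
  have aab: "a \<otimes> a \<otimes> b = b \<otimes> (a \<otimes> a)"
  proof -
    have "a \<otimes> a \<otimes> b = a \<otimes> (b \<otimes> a \<otimes> c)" unfolding ab[symmetric] using cl by (simp add: m_assoc)
    also have "\<dots> = (a \<otimes> b) \<otimes> (a \<otimes> c)" using cl by (simp add: m_assoc)
    also have "\<dots> = b \<otimes> a \<otimes> c \<otimes> (c \<otimes> a)" by (simp only: ab ca)
    also have "\<dots> = b \<otimes> a \<otimes> (c \<otimes> c) \<otimes> a" using cl by (simp add: m_assoc)
    also have "\<dots> = b \<otimes> (a \<otimes> a)" using cl by (simp add: cc m_assoc)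
    finally show ?thesis .
  qed
  have 1: "(a \<otimes> a) [^] (2 ^ m :: nat) = c" "(a \<otimes> a) [^] (2 * 2 ^ m :: nat) = \<one>"
    using cl a by (simp_all add: nat_pow_pow c_def n flip: pow_two)
  have 2: "b \<otimes> a = a \<otimes> (b \<otimes> c)" using ba cl by (simp add: m_assoc)
  have 3: "a \<otimes> a \<otimes> a = a \<otimes> (a \<otimes> a)" using cl by (simp add: m_assoc)
  show ?thesis
    unfolding satisfies_def normal_relations_def
    by (simp add: word_value_simps f 1 2 3 bb aab cl pow_two n flip: a_def b_def)
qed

section \<open>Recognition of Q(1,1), R(1), Q(n,1) and Q(n,0)\<close>

lemma ord_involution: "c \<in> carrier G \<Longrightarrow> c \<otimes> c = \<one> \<Longrightarrow> c \<noteq> \<one> \<Longrightarrow> ord c = 2"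
  by (metis ord_eq_1 pow_eq_id prime_nat_iff pow_two two_is_prime_nat)

text \<open>Since 2r > n here, the second presentation applies. Its relations a^2 = 1 and a^2 =
  [a,b]^2 make [a,b] a central element of square one: this is the dihedral group of order 8,
  generated by two noncommuting involutions.\<close>

lemma Q_1_1_iso:
  assumes "x \<in> carrier G" "y \<in> carrier G" "c \<in> carrier G" "c \<noteq> \<one>" "c \<otimes> c = \<one>"
    "c \<otimes> x = x \<otimes> c" "c \<otimes> y = y \<otimes> c" "x \<otimes> y = y \<otimes> x \<otimes> c" "x \<otimes> x = \<one>" "y \<otimes> y = \<one>"
  shows "G\<lparr>carrier := range (word_value G (case_ab x y))\<rparr> \<cong> Q_group 1 1"
proof -
  let ?f = "case_ab x y"
  let ?R = "{(wpow wa 2, []), (wpow wb 2, []), (wpow wa 2, wpow (wcomm wa wb) 2),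
    (wcomm (wcomm wa wb) wa, []), (wcomm (wcomm wa wb) wb, [])}"
  let ?S = "{(wpow (wcomm wa wb) 2, []), (wcomm (wcomm wa wb) wa, []),
    (wcomm (wcomm wa wb) wb, []), (wa @ wa, wpow (wcomm wa wb) 0), (wb @ wb, wpow (wcomm wa wb) 0)}"
  have f: "?f z \<in> carrier G" for z using assms by (cases z) auto
  have comm: "inv x \<otimes> (inv y \<otimes> (x \<otimes> y)) = c"
    using commutator_eq_iff[OF assms(1-3)] assms(8) by blast
  have cen: "inv c \<otimes> (inv x \<otimes> (c \<otimes> x)) = \<one>" "inv c \<otimes> (inv y \<otimes> (c \<otimes> y)) = \<one>"
    by (rule commutator_eq_iff[THEN iffD2]; simp add: assms)+
  \<comment> \<open>Stated for an arbitrary group because it serves twice, for G and for the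
    presented group itself.\<close>
  have norm: "satisfies H g (normal_relations (wcomm wa wb) 2 0 0 1)"
    if H: "group H" "\<And>z. g z \<in> carrier H" and r: "satisfies H g ?R" for H :: "('c, 'd) monoid_scheme" and g
  proof -
    interpret H: group H by fact
    note D = satisfiesD[OF r]
    have c: "word_value H g (wcomm wa wb) \<in> carrier H" by (rule H.word_value_closed) fact
    have "satisfies H g ?S"
      using D[of "wpow wa 2" "[]"] D[of "wpow wb 2" "[]"] D[of "wpow wa 2" "wpow (wcomm wa wb) 2"]
        D[of "wcomm (wcomm wa wb) wa" "[]"] D[of "wcomm (wcomm wa wb) wb" "[]"] c
      by (simp add: satisfies_def H.word_value_append H.word_value_wpow H.word_value_gen H H.pow_two)
    then show ?thesis by (rule H.commutator_involution_normal_relations[OF H(2)])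
  qed
  have sat: "satisfies G ?f ?R"
    using assms(9,10) by (simp add: satisfies_def word_value_simps f comm cen assms(1-3,5) pow_two)
  have "G\<lparr>carrier := range (word_value G ?f)\<rparr> \<cong> presented_group ?R"
  proof (rule two_generator_presented_group_iso)
    show "ord (word_value G ?f (wcomm wa wb)) = 2"
      by (simp add: word_value_simps f comm ord_involution assms(1-5))
    show "?f Gen_a \<otimes> ?f Gen_b \<noteq> ?f Gen_b \<otimes> ?f Gen_a" using assms by simp
    show "satisfies G ?f (normal_relations (wcomm wa wb) 2 0 0 1)" by (rule norm[OF _ f sat]) simp
  qed (use f sat norm[OF group_presented_group _ presented_group_satisfies]
        in \<open>auto simp: presented_group_carrier\<close>)
  then show ?thesis by (simp add: Q_group_def)
qed

text \<open>For n = 1 the relations read a^4 = b^4 = 1 and a^2 = [a,b] = b^2, the quaternion group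
  of order 8. That [a,b] has square one comes from a^4 = 1.\<close>

lemma R_1_iso:
  assumes "x \<in> carrier G" "y \<in> carrier G" "c \<in> carrier G" "c \<noteq> \<one>" "c \<otimes> c = \<one>"
    "c \<otimes> x = x \<otimes> c" "c \<otimes> y = y \<otimes> c" "x \<otimes> y = y \<otimes> x \<otimes> c" "x \<otimes> x = c" "y \<otimes> y = c"
  shows "G\<lparr>carrier := range (word_value G (case_ab x y))\<rparr> \<cong> R_group 1"
proof -
  let ?f = "case_ab x y"
  let ?R = "{(wpow wa 4, []), (wpow wb 4, []), (wpow wa 2, wpow (wcomm wa wb) 1),
    (wpow (wcomm wa wb) 1, wpow wb 2),
    (wcomm (wcomm wa wb) wa, []), (wcomm (wcomm wa wb) wb, [])}"
  let ?S = "{(wpow (wcomm wa wb) 2, []), (wcomm (wcomm wa wb) wa, []),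
    (wcomm (wcomm wa wb) wb, []), (wa @ wa, wpow (wcomm wa wb) 1), (wb @ wb, wpow (wcomm wa wb) 1)}"
  have f: "?f z \<in> carrier G" for z using assms by (cases z) auto
  have comm: "inv x \<otimes> (inv y \<otimes> (x \<otimes> y)) = c"
    using commutator_eq_iff[OF assms(1-3)] assms(8) by blast
  have cen: "inv c \<otimes> (inv x \<otimes> (c \<otimes> x)) = \<one>" "inv c \<otimes> (inv y \<otimes> (c \<otimes> y)) = \<one>"
    by (rule commutator_eq_iff[THEN iffD2]; simp add: assms)+
  have norm: "satisfies H g (normal_relations (wcomm wa wb) 2 1 1 1)"
    if H: "group H" "\<And>z. g z \<in> carrier H" and r: "satisfies H g ?R" for H :: "('c, 'd) monoid_scheme" and g
  proof -
    interpret H: group H by fact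
    note D = satisfiesD[OF r]
    let ?c = "word_value H g (wcomm wa wb)"
    have c: "?c \<in> carrier H" by (rule H.word_value_closed) fact
    have aa: "g Gen_a \<otimes>\<^bsub>H\<^esub> g Gen_a = ?c"
      using D[of "wpow wa 2" "wpow (wcomm wa wb) 1"] c
      by (simp add: H.word_value_wpow H.word_value_gen H H.pow_two)
    have bb: "g Gen_b \<otimes>\<^bsub>H\<^esub> g Gen_b = ?c"
      using D[of "wpow (wcomm wa wb) 1" "wpow wb 2"] c
      by (simp add: H.word_value_wpow H.word_value_gen H H.pow_two)
    have "(g Gen_a \<otimes>\<^bsub>H\<^esub> g Gen_a) \<otimes>\<^bsub>H\<^esub> (g Gen_a \<otimes>\<^bsub>H\<^esub> g Gen_a) = \<one>\<^bsub>H\<^esub>"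
      using D[of "wpow wa 4" "[]"]
      by (simp add: H.word_value_wpow H.word_value_gen H H.pow_two H.m_assoc eval_nat_numeral)
    then have cc: "?c \<otimes>\<^bsub>H\<^esub> ?c = \<one>\<^bsub>H\<^esub>" by (simp only: aa)
    have "satisfies H g ?S"
      using D[of "wcomm (wcomm wa wb) wa" "[]"] D[of "wcomm (wcomm wa wb) wb" "[]"] c
      by (simp add: satisfies_def H.word_value_append H.word_value_wpow H.word_value_gen H aa bb cc H.pow_two)
    then show ?thesis by (rule H.commutator_involution_normal_relations[OF H(2)])
  qed
  have 4: "x [^] (4::nat) = \<one>" "y [^] (4::nat) = \<one>"
    using assms(1,2,3,5,9,10) by (simp_all add: eval_nat_numeral m_assoc)
  have sat: "satisfies G ?f ?R"
    by (simp add: satisfies_def word_value_simps f comm cen pow_two assms(1-3,9,10) 4)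
  have "G\<lparr>carrier := range (word_value G ?f)\<rparr> \<cong> presented_group ?R"
  proof (rule two_generator_presented_group_iso)
    show "ord (word_value G ?f (wcomm wa wb)) = 2"
      by (simp add: word_value_simps f comm ord_involution assms(1-5))
    show "?f Gen_a \<otimes> ?f Gen_b \<noteq> ?f Gen_b \<otimes> ?f Gen_a" using assms by simp
    show "satisfies G ?f (normal_relations (wcomm wa wb) 2 1 1 1)" by (rule norm[OF _ f sat]) simp
  qed (use f sat norm[OF group_presented_group _ presented_group_satisfies]
        in \<open>auto simp: presented_group_carrier\<close>)
  then show ?thesis by (simp add: R_group_def)
qed

text \<open>The normal form is taken over the powers of x^2, whose order 2^(n-1) is the number N
  required. For n > 2 this is the modular group of order 2^(n+1).\<close>

lemma Q_n_1_iso: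
  assumes "x \<in> carrier G" "y \<in> carrier G" "n \<ge> 2" "ord x = 2 ^ n" "y \<otimes> y = \<one>"
    "x \<otimes> y = y \<otimes> x \<otimes> x [^] (2 ^ (n - 1) :: nat)"
  shows "G\<lparr>carrier := range (word_value G (case_ab x y))\<rparr> \<cong> Q_group n 1"
proof -
  let ?f = "case_ab x y"
  let ?R = "{(wpow wa (2 ^ n), []), (wpow wb 2, []), (wpow wa (2 ^ (n - 1)), wcomm wa wb)}"
  let ?N = "normal_relations (wpow wa 2) (2 ^ (n - 1)) 1 0 (2 ^ (n - 2))"
  define c where "c = x [^] (2 ^ (n - 1) :: nat)"
  have cc: "c \<in> carrier G" using assms by (simp add: c_def)
  have f: "?f z \<in> carrier G" for z using assms by (cases z) auto
  have comm: "inv x \<otimes> (inv y \<otimes> (x \<otimes> y)) = c"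
    using commutator_eq_iff[OF assms(1,2) cc] assms(6) by (simp add: c_def)
  have ne: "c \<noteq> \<one>"
    using assms(1,3,4) by (auto simp: c_def pow_eq_id dest!: dvd_imp_le)
  have one: "x [^] (2 ^ n :: nat) = \<one>"
    using assms(1,4) by (metis pow_ord_eq_1)
  have sat: "satisfies G ?f ?R"
    using assms(1,2,5) one c_def by (simp add: satisfies_def word_value_simps f comm pow_two)
  have "G\<lparr>carrier := range (word_value G ?f)\<rparr> \<cong> presented_group ?R"
  proof (rule two_generator_presented_group_iso)
    show "ord (word_value G ?f (wpow wa 2)) = 2 ^ (n - 1)"
      using assms(1,3,4) by (cases n) (simp_all add: word_value_simps f ord_pow)
    show "?f Gen_a \<otimes> ?f Gen_b \<noteq> ?f Gen_b \<otimes> ?f Gen_a"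
      using assms(1,2) ne cc by (simp add: assms(6)) (simp add: c_def)
    show "satisfies G ?f ?N" by (rule modular_normal_relations[OF f \<open>n \<ge> 2\<close> sat])
  qed (use f sat group.modular_normal_relations[OF group_presented_group _ \<open>n \<ge> 2\<close> presented_group_satisfies]
        in \<open>auto simp: presented_group_carrier\<close>)
  then show ?thesis using \<open>n \<ge> 2\<close> by (simp add: Q_group_def)
qed

text \<open>The relation b^(2^0) = 1 kills b. A value then depends only on the exponent sum
  \<open>e w\<close> of the letter a, both in G and in the presented group, and is trivial in G only
  if 2^n divides that sum.\<close>

lemma Q_n_0_iso:
  assumes x: "x \<in> carrier G" and o: "ord x = 2 ^ n"
  shows "G\<lparr>carrier := range (\<lambda>i::int. x [^] i)\<rparr> \<cong> Q_group n 0"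
proof -
  define e :: "ab word \<Rightarrow> int" where
    "e w = (\<Sum>(s, z)\<leftarrow>w. if z = Gen_a then (if s then 1 else - 1) else 0)" for w
  have e: "word_value H g w = g Gen_a [^]\<^bsub>H\<^esub> e w"
    if H: "group H" "\<And>z. g z \<in> carrier H" "g Gen_b = \<one>\<^bsub>H\<^esub>" for H :: "('c, 'd) monoid_scheme" and g w
  proof (induction w)
    case (Cons l w)
    interpret H: group H by fact
    obtain s z where l: "l = (s, z)" by (cases l)
    have "inv\<^bsub>H\<^esub> g Gen_a \<otimes>\<^bsub>H\<^esub> g Gen_a [^]\<^bsub>H\<^esub> k = g Gen_a [^]\<^bsub>H\<^esub> (k - 1)" for k :: int
      using H.int_pow_mult[OF H(2), of Gen_a "- 1" k] by (simp add: H.int_pow_neg H(2))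
    then show ?case
      using H(3) by (cases z; cases s) (simp_all add: l Cons e_def H.int_pow_mult H(2))
  qed (simp add: e_def)
  let ?f = "case_ab x \<one>"
  let ?R = "{(wpow wa (2 ^ n), []), (wpow wb (Suc 0), []), (wpow wa (2 ^ n), wcomm wa wb)}"
  have f: "?f z \<in> carrier G" for z using assms by (cases z) auto
  have ef: "word_value G ?f w = x [^] e w" for w
    using e[OF _ f] by simp
  have "range (word_value G ?f) = range (\<lambda>i::int. x [^] i)"
  proof
    show "range (\<lambda>i::int. x [^] i) \<subseteq> range (word_value G ?f)"
    proof safe
      fix i :: int
      interpret H: subgroup "range (word_value G ?f)" G by (rule subgroup_range_word_value) (rule f)
      have "word_value G ?f wa = x" using f by (simp add: word_value_gen)
      then have "x \<in> range (word_value G ?f)" by (metis rangeI)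
      then show "x [^] i \<in> range (word_value G ?f)"
        by (rule subgroup_int_pow_closed[OF H.subgroup_axioms])
    qed
  qed (auto simp: ef)
  moreover have "G\<lparr>carrier := range (word_value G ?f)\<rparr> \<cong> presented_group ?R"
  proof (rule presented_group_iso[OF is_group f])
    have "x [^] (2 ^ n :: nat) = \<one>" using o x by (metis pow_ord_eq_1)
    then show "satisfies G ?f ?R"
      by (simp add: satisfies_def word_value_simps f x)
    fix w
    let ?U = "presented_group ?R"
    define g where "g = (\<lambda>x. word_rel ?R `` {gen x})"
    interpret U: group ?U by (rule group_presented_group)
    have g: "g z \<in> carrier ?U" for z by (auto simp: presented_group_carrier g_def)
    note D = satisfiesD[OF presented_group_satisfies[of ?R], folded g_def]
    have b: "g Gen_b = \<one>\<^bsub>?U\<^esub>"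
      using D[of "wpow wb (Suc 0)" "[]"] by (simp add: U.word_value_wpow U.word_value_gen g)
    have a: "g Gen_a [^]\<^bsub>?U\<^esub> (2 ^ n :: nat) = \<one>\<^bsub>?U\<^esub>"
      using D[of "wpow wa (2 ^ n)" "[]"] by (simp add: U.word_value_wpow U.word_value_gen g)
    assume "word_value G ?f w = \<one>"
    then have "int (2 ^ n) dvd e w" using o x by (simp add: ef int_pow_eq_id)
    moreover have "int (U.ord (g Gen_a)) dvd int (2 ^ n)"
      using a g U.pow_eq_id by (simp only: int_dvd_int_iff)
    ultimately have "int (U.ord (g Gen_a)) dvd e w" by (rule dvd_trans[rotated])
    then have "word_value ?U g w = \<one>\<^bsub>?U\<^esub>"
      using e[of ?U g, OF group_presented_group g b] g by (simp add: U.int_pow_eq_id)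
    then show "word_value ?U (\<lambda>x. word_rel ?R `` {gen x}) w = \<one>\<^bsub>?U\<^esub>" by (simp only: g_def)
  qed
  ultimately show ?thesis by (simp add: Q_group_def)
qed

end

subsection \<open>Central products\<close>

context group
begin

abbreviation commute (infix "\<bowtie>" 50) where "x \<bowtie> y \<equiv> x \<otimes> y = y \<otimes> x"

lemma commute_mult:
  "x \<in> carrier G \<Longrightarrow> y \<in> carrier G \<Longrightarrow> u \<in> carrier G \<Longrightarrow> x \<bowtie> u \<Longrightarrow> y \<bowtie> u \<Longrightarrow> x \<otimes> y \<bowtie> u"
  by (metis m_assoc)

lemma commute_cancel_left:
  assumes "x \<in> carrier G" "y \<in> carrier G" "u \<in> carrier G" "x \<bowtie> u" "x \<otimes> y \<bowtie> u"
  shows "y \<bowtie> u"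
proof -
  have "inv x \<otimes> (x \<otimes> y) \<bowtie> u" by (intro commute_mult commutes_inv assms inv_closed m_closed)
  moreover have "inv x \<otimes> (x \<otimes> y) = y" using assms(1,2) by (simp flip: m_assoc)
  ultimately show ?thesis by simp
qed

lemma commute_cancel_right:
  assumes "x \<in> carrier G" "y \<in> carrier G" "u \<in> carrier G" "y \<bowtie> u" "x \<otimes> y \<bowtie> u"
  shows "x \<bowtie> u"
proof -
  have "(x \<otimes> y) \<otimes> inv y \<bowtie> u" by (intro commute_mult[of "x \<otimes> y"] commutes_inv assms inv_closed m_closed)
  moreover have "(x \<otimes> y) \<otimes> inv y = x" using assms(1,2) by (simp add: m_assoc)
  ultimately show ?thesis by simp
qed

lemma centralizer_subgroup:
  assumes u: "u \<in> carrier G"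
  shows "subgroup (centralizer G u) G"
proof (rule subgroupI)
  show "centralizer G u \<subseteq> carrier G" by (auto simp: centralizer_def)
  have "\<one> \<in> centralizer G u" using u by (simp add: centralizer_def)
  then show "centralizer G u \<noteq> {}" by blast
  show "inv a \<in> centralizer G u" if "a \<in> centralizer G u" for a
    using that commutes_inv[of a u] u unfolding centralizer_def by blast
  show "a \<otimes> b \<in> centralizer G u" if "a \<in> centralizer G u" "b \<in> centralizer G u" for a b
    using that commute_mult[of a b u] u unfolding centralizer_def by blast
qed

lemma center_closed: "u \<in> center G \<Longrightarrow> u \<in> carrier G"
  by (simp add: center_def)

lemma center_commute: "u \<in> center G \<Longrightarrow> x \<in> carrier G \<Longrightarrow> u \<bowtie> x"
  by (simp add: center_def)

lemma centerI: "u \<in> carrier G \<Longrightarrow> (\<And>x. x \<in> carrier G \<Longrightarrow> u \<bowtie> x) \<Longrightarrow> u \<in> center G"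
  by (simp add: center_def)

lemma center_subgroup: "subgroup (center G) G"
proof (rule subgroupI)
  show "center G \<subseteq> carrier G" by (auto simp: center_def)
  have "\<one> \<in> center G" by (simp add: center_def)
  then show "center G \<noteq> {}" by blast
  show "inv a \<in> center G" if "a \<in> center G" for a
    using that by (blast intro: centerI commutes_inv center_commute inv_closed dest: center_closed)
  show "a \<otimes> b \<in> center G" if "a \<in> center G" "b \<in> center G" for a b
    using that by (blast intro: centerI commute_mult center_commute m_closed dest: center_closed)
qed

lemma subgroup_set_mult_commute:
  assumes K: "subgroup K G" and L: "subgroup L G" and c: "\<And>x y. x \<in> K \<Longrightarrow> y \<in> L \<Longrightarrow> x \<bowtie> y"
  shows "subgroup (K <#> L) G"
proof (rule subgroupI)
  interpret K: subgroup K G by fact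
  interpret L: subgroup L G by fact
  show "K <#> L \<subseteq> carrier G" by (auto simp: set_mult_def)
  have "\<one> \<otimes> \<one> \<in> K <#> L"
    using K.one_closed L.one_closed unfolding set_mult_def by blast
  then show "K <#> L \<noteq> {}" by blast
  fix a assume "a \<in> K <#> L"
  then obtain x y where a: "a = x \<otimes> y" "x \<in> K" "y \<in> L" by (auto simp: set_mult_def)
  have "inv a = inv x \<otimes> inv y"
    using a c[OF K.m_inv_closed[of x] L.m_inv_closed[of y]] by (simp add: inv_mult_group)
  then show "inv a \<in> K <#> L" using a by (auto simp: set_mult_def)
  fix b assume "b \<in> K <#> L"
  then obtain x' y' where b: "b = x' \<otimes> y'" "x' \<in> K" "y' \<in> L" by (auto simp: set_mult_def)
  have "a \<otimes> b = x \<otimes> (y \<otimes> x') \<otimes> y'" using a b by (simp add: m_assoc)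
  also have "y \<otimes> x' = x' \<otimes> y" by (rule c[symmetric]) (use a b in auto)
  also have "x \<otimes> (x' \<otimes> y) \<otimes> y' = (x \<otimes> x') \<otimes> (y \<otimes> y')" using a b by (simp add: m_assoc)
  finally show "a \<otimes> b \<in> K <#> L" using a b by (auto simp: set_mult_def)
qed

text \<open>Products of sets do not see the carrier, so decompositions of subgroups can all be
  handled inside G. This is what makes an induction over subgroups possible.\<close>

lemma central_decomposition_carrier_iff:
  "central_decomposition (G\<lparr>carrier := M\<rparr>) Hs \<longleftrightarrow>
     (\<exists>Ks. list_all2 (\<lambda>K H. subgroup K (G\<lparr>carrier := M\<rparr>) \<and> G\<lparr>carrier := K\<rparr> \<cong> H) Ks Hs \<and>
           (\<forall>i < length Ks. \<forall>j < length Ks. i \<noteq> j \<longrightarrow> (\<forall>x \<in> Ks ! i. \<forall>y \<in> Ks ! j. x \<bowtie> y)) \<and>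
           M = foldr (<#>) Ks {\<one>})"
proof -
  have "(<#>\<^bsub>G\<lparr>carrier := M\<rparr>\<^esub>) = (<#>)" by (simp add: set_mult_def fun_eq_iff)
  then show ?thesis unfolding central_decomposition_def by simp
qed

lemma central_decomposition_Nil: "central_decomposition (G\<lparr>carrier := {\<one>}\<rparr>) []"
  by (simp add: central_decomposition_def)

text \<open>The factors of the given decomposition lie in \<open>L\<close>, so commuting with
  \<open>K\<close> is inherited by each of them.\<close>

lemma central_decomposition_Cons:
  assumes K: "subgroup K G" and L: "subgroup L G" and c: "\<And>x y. x \<in> K \<Longrightarrow> y \<in> L \<Longrightarrow> x \<bowtie> y"
    and H: "G\<lparr>carrier := K\<rparr> \<cong> H" and D: "central_decomposition (G\<lparr>carrier := L\<rparr>) Hs"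
  shows "central_decomposition (G\<lparr>carrier := K <#> L\<rparr>) (H # Hs)"
proof -
  let ?M = "K <#> L"
  interpret K: subgroup K G by fact
  interpret L: subgroup L G by fact
  have M: "subgroup ?M G" by (rule subgroup_set_mult_commute[OF K L c])
  have KM: "K \<subseteq> ?M"
  proof
    fix x assume "x \<in> K"
    then have "x = x \<otimes> \<one>" by simp
    then show "x \<in> ?M" using \<open>x \<in> K\<close> L.one_closed unfolding set_mult_def by blast
  qed
  have LM: "L \<subseteq> ?M"
  proof
    fix x assume "x \<in> L"
    then have "x = \<one> \<otimes> x" by simp
    then show "x \<in> ?M" using \<open>x \<in> L\<close> K.one_closed unfolding set_mult_def by blast
  qed
  obtain Ks where Ks: "list_all2 (\<lambda>K H. subgroup K (G\<lparr>carrier := L\<rparr>) \<and> G\<lparr>carrier := K\<rparr> \<cong> H) Ks Hs"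
    and comm: "\<And>i j x y. i < length Ks \<Longrightarrow> j < length Ks \<Longrightarrow> i \<noteq> j \<Longrightarrow> x \<in> Ks ! i \<Longrightarrow> y \<in> Ks ! j \<Longrightarrow> x \<bowtie> y"
    and prod: "L = foldr (<#>) Ks {\<one>}"
    using D unfolding central_decomposition_carrier_iff by auto
  have sub: "J \<subseteq> L" "subgroup J G" if "subgroup J (G\<lparr>carrier := L\<rparr>)" for J
    using that subgroup.subset incl_subgroup[OF L] by fastforce+
  have sub': "subgroup J (G\<lparr>carrier := ?M\<rparr>)" if "subgroup J (G\<lparr>carrier := L\<rparr>)" for J
    using subgroup_incl[OF sub(2)[OF that] M] sub(1)[OF that] LM by blast
  have in_L: "Ks ! i \<subseteq> L" if "i < length Ks" for i
    using Ks that sub by (auto simp: list_all2_conv_all_nth)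
  have "list_all2 (\<lambda>K H. subgroup K (G\<lparr>carrier := ?M\<rparr>) \<and> G\<lparr>carrier := K\<rparr> \<cong> H) (K # Ks) (H # Hs)"
    using Ks K H subgroup_incl[OF K M KM] sub' by (auto elim!: list_all2_mono)
  moreover have "x \<bowtie> y" if ij: "i < length (K # Ks)" "j < length (K # Ks)" "i \<noteq> j"
    "x \<in> (K # Ks) ! i" "y \<in> (K # Ks) ! j" for i j x y
  proof (cases i)
    case 0
    then obtain j' where "j = Suc j'" using ij(3) by (cases j) auto
    then have "x \<in> K" "y \<in> L" using 0 ij in_L[of j'] by auto
    then show ?thesis by (rule c)
  next
    case (Suc i')
    show ?thesis
    proof (cases j)
      case 0
      then have "y \<in> K" "x \<in> L" using Suc ij in_L[of i'] by auto
      then show ?thesis by (rule c[symmetric])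
    next
      case (Suc j')
      then show ?thesis using \<open>i = Suc i'\<close> ij by (intro comm[of i' j']) auto
    qed
  qed
  moreover have "?M = foldr (<#>) (K # Ks) {\<one>}"
    using prod by simp
  ultimately show ?thesis
    unfolding central_decomposition_carrier_iff by blast
qed

end

subsection \<open>2-groups with cyclic center and central squares\<close>

text \<open>This is all that later arguments retain of the number of centralizers. It says that G
  modulo its center is an elementary abelian 2-group.\<close>

locale central_squares = group +
  assumes square_central: "x \<in> carrier G \<Longrightarrow> x \<otimes> x \<in> center G"
begin

text \<open>Solving (xy)^2 = x^2 y^2 d for d exhibits the commutator as a product of squares and
  inverses of squares, hence as central.\<close>

lemma commutator_central_involution:
  assumes x: "x \<in> carrier G" and y: "y \<in> carrier G"
  shows "\<exists>d \<in> center G. d \<otimes> d = \<one> \<and> y \<otimes> x = x \<otimes> y \<otimes> d"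
proof -
  interpret Z: subgroup "center G" G by (rule center_subgroup)
  define d where "d = inv (x \<otimes> x) \<otimes> ((x \<otimes> y) \<otimes> (x \<otimes> y)) \<otimes> inv (y \<otimes> y)"
  have d: "d \<in> center G" unfolding d_def by (intro Z.m_closed Z.m_inv_closed square_central) (simp_all add: x y)
  then have dc: "d \<in> carrier G" by (rule center_closed)
  have "x \<otimes> d \<otimes> y = x \<otimes> (inv (x \<otimes> x) \<otimes> ((x \<otimes> y) \<otimes> (x \<otimes> y)) \<otimes> (inv (y \<otimes> y) \<otimes> y))"
    using x y by (simp add: d_def m_assoc)
  also have "\<dots> = y \<otimes> x"
    using x y by (simp add: inv_mult_group m_assoc) (simp flip: m_assoc)
  finally have "y \<otimes> x = x \<otimes> (d \<otimes> y)" using x y dc by (simp add: m_assoc)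
  then have yx: "y \<otimes> x = x \<otimes> y \<otimes> d" using center_commute[OF d y] x y dc by (simp add: m_assoc)
  \<comment> \<open>Moving y across both factors of the central element x^2 produces d twice, so d^2
    = 1.\<close>
  have "x \<otimes> x \<otimes> y = y \<otimes> x \<otimes> x"
    using center_commute[OF square_central[OF x] y] x y by (simp add: m_assoc)
  also have "\<dots> = x \<otimes> y \<otimes> d \<otimes> x" by (simp only: yx)
  also have "\<dots> = x \<otimes> y \<otimes> (d \<otimes> x)" using x y dc by (simp add: m_assoc)
  also have "\<dots> = x \<otimes> (y \<otimes> x) \<otimes> d" using x y dc center_commute[OF d x] by (simp add: m_assoc)
  also have "\<dots> = x \<otimes> (x \<otimes> y \<otimes> d) \<otimes> d" by (simp only: yx)
  also have "\<dots> = x \<otimes> x \<otimes> y \<otimes> (d \<otimes> d)" using x y dc by (simp add: m_assoc)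
  finally have "x \<otimes> x \<otimes> y \<otimes> (d \<otimes> d) = x \<otimes> x \<otimes> y \<otimes> \<one>" using x y by simp
  then have "d \<otimes> d = \<one>" using x y dc by (simp only: l_cancel m_closed one_closed)
  then show ?thesis using d yx by blast
qed

end

text \<open>As squares lie in a center of order 2^k, every element has order dividing 2^(k+1). The
  bound on \<open>k\<close> provides an involution in the center.\<close>

locale cyclic_center_two_group = central_squares +
  fixes z k
  assumes fin: "finite (carrier G)" and z: "z \<in> carrier G" and center_eq: "center G = range (\<lambda>i::int. z [^] i)"
    and ord_z: "ord z = 2 ^ k" and k: "k \<ge> 1"
begin

text \<open>The only involution of the center, and therefore the only nontrivial commutator.\<close>

definition c where "c = z [^] (2 ^ (k - 1) :: int)"

lemma pow_z_center: "z [^] (i::int) \<in> center G"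
  by (simp add: center_eq)

lemma pow_z_eq: "z [^] (i::int) = z [^] (j::int) \<longleftrightarrow> 2 ^ k dvd i - j"
  using z by (simp add: int_pow_eq ord_z)  (simp add: dvd_diff_commute)

lemma c_center: "c \<in> center G" by (simp add: c_def pow_z_center)

lemma c_closed [simp]: "c \<in> carrier G" using c_center by (rule center_closed)

lemma two_pow_k: "(2::int) ^ k = 2 * 2 ^ (k - 1)"
  using k by (cases k) auto

lemma c_involution: "c \<otimes> c = \<one>"
proof -
  have "c \<otimes> c = z [^] (2 ^ k :: int)" using z by (simp add: c_def two_pow_k flip: int_pow_mult)
  also have "\<dots> = z [^] (0 :: int)" unfolding pow_z_eq by simp
  finally show ?thesis by simp
qed

lemma c_ne: "c \<noteq> \<one>"
proof
  assume "c = \<one>"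
  then have "z [^] (2 ^ (k - 1) :: int) = z [^] (0 :: int)" by (simp add: c_def)
  then have "(2::int) ^ k dvd 2 ^ (k - 1)" unfolding pow_z_eq by simp
  then show False using k by (simp add: two_pow_k)
qed

lemma central_involution:
  assumes "d \<in> center G" "d \<otimes> d = \<one>"
  shows "d = \<one> \<or> d = c"
proof -
  obtain i :: int where i: "d = z [^] i" using assms center_eq by auto
  have "z [^] (i + i) = z [^] (0::int)"
    using assms(2) z unfolding i by (simp only: int_pow_mult int_pow_0)
  then have "2 * 2 ^ (k - 1) dvd 2 * i" unfolding pow_z_eq by (simp add: two_pow_k)
  then have "2 ^ (k - 1) dvd i" by (metis dvd_mult_cancel_left zero_neq_numeral)
  then obtain m where m: "i = 2 ^ (k - 1) * m" ..
  show ?thesis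
  proof (cases "even m")
    case True
    then have "2 ^ k dvd i - 0" by (auto simp: m two_pow_k)
    then show ?thesis unfolding i using pow_z_eq[of i 0] by simp
  next
    case False
    then have "2 ^ k dvd i - 2 ^ (k - 1)" by (auto simp: m two_pow_k elim!: oddE simp: algebra_simps)
    then show ?thesis unfolding i c_def using pow_z_eq by simp
  qed
qed

lemma non_commute:
  assumes "x \<in> carrier G" "y \<in> carrier G" "\<not> x \<bowtie> y"
  shows "y \<otimes> x = x \<otimes> y \<otimes> c"
proof -
  obtain d where d: "d \<in> center G" "d \<otimes> d = \<one>" "y \<otimes> x = x \<otimes> y \<otimes> d"
    using commutator_central_involution[OF assms(1,2)] by blast
  then have "d \<noteq> \<one>" using assms by auto
  then show ?thesis using central_involution d by blast
qed

lemma c_commute: "x \<in> carrier G \<Longrightarrow> c \<otimes> x = x \<otimes> c"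
  by (rule center_commute[OF c_center])

text \<open>Additivity of the commutator form over the field with two elements: the two factors c
  cancel.\<close>

lemma non_commute_mult:
  assumes cl: "x \<in> carrier G" "y \<in> carrier G" "u \<in> carrier G" and nc: "\<not> x \<bowtie> u" "\<not> y \<bowtie> u"
  shows "x \<otimes> y \<bowtie> u"
proof -
  have 1: "u \<otimes> x = x \<otimes> u \<otimes> c" "u \<otimes> y = y \<otimes> u \<otimes> c"
    by (intro non_commute cl nc)+
  have "u \<otimes> (x \<otimes> y) = u \<otimes> x \<otimes> y" using cl by (simp add: m_assoc)
  also have "\<dots> = x \<otimes> u \<otimes> (c \<otimes> y)" using cl by (simp add: 1(1) m_assoc)
  also have "\<dots> = x \<otimes> (u \<otimes> y) \<otimes> c" using cl by (simp add: m_assoc c_commute)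
  also have "\<dots> = x \<otimes> (y \<otimes> u \<otimes> c) \<otimes> c" by (simp only: 1(2))
  also have "\<dots> = x \<otimes> y \<otimes> u \<otimes> (c \<otimes> c)" using cl by (simp add: m_assoc)
  finally show ?thesis using cl by (simp add: c_involution)
qed

lemma square_mult_commute:
  assumes "x \<in> carrier G" "y \<in> carrier G" "x \<bowtie> y"
  shows "(x \<otimes> y) \<otimes> (x \<otimes> y) = (x \<otimes> x) \<otimes> (y \<otimes> y)"
proof -
  have "(x \<otimes> y) \<otimes> (x \<otimes> y) = x \<otimes> (y \<otimes> x) \<otimes> y" using assms(1,2) by (simp add: m_assoc)
  also have "\<dots> = x \<otimes> (x \<otimes> y) \<otimes> y" by (simp only: assms(3))
  finally show ?thesis using assms(1,2) by (simp add: m_assoc)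
qed

text \<open>Together with the commuting case this is polarization: squaring is a quadratic map whose
  polar form is the commutator.\<close>

lemma square_mult_non_commute:
  assumes "x \<in> carrier G" "y \<in> carrier G" "\<not> x \<bowtie> y"
  shows "(x \<otimes> y) \<otimes> (x \<otimes> y) = (x \<otimes> x) \<otimes> (y \<otimes> y) \<otimes> c"
proof -
  have "(x \<otimes> y) \<otimes> (x \<otimes> y) = x \<otimes> (y \<otimes> x) \<otimes> y" using assms by (simp add: m_assoc)
  also have "\<dots> = x \<otimes> (x \<otimes> y \<otimes> c) \<otimes> y" by (simp only: non_commute[OF assms])
  also have "\<dots> = (x \<otimes> x) \<otimes> (y \<otimes> y) \<otimes> c" using assms(1,2) by (simp add: m_assoc c_commute)
  finally show ?thesis .
qed

section \<open>Nondegenerate subgroups and orthogonal complements of the commutator form\<close>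

text \<open>The commutator form on S modulo Z(G) has trivial radical; equivalently, S contains Z(G)
  and has it as its own center.\<close>

definition nondegenerate where
  "nondegenerate S \<longleftrightarrow> subgroup S G \<and> center G \<subseteq> S \<and> (\<forall>u \<in> S. (\<forall>s \<in> S. u \<bowtie> s) \<longrightarrow> u \<in> center G)"

text \<open>The orthogonal complement in S of the plane spanned by x and y.\<close>

definition perp where "perp S x y = {s \<in> S. s \<bowtie> x \<and> s \<bowtie> y}"

text \<open>The plane spanned by noncommuting x and y is nondegenerate, so exactly one of 1, x, y,
  xy behaves towards x and y as p does. Multiplying by it cancels both commutators.\<close>

lemma mult_into_centralizers:
  assumes x: "x \<in> carrier G" and y: "y \<in> carrier G" and nc: "\<not> x \<bowtie> y" and p: "p \<in> carrier G"
  shows "\<exists>d \<in> {\<one>, x, y, x \<otimes> y}. d \<otimes> p \<bowtie> x \<and> d \<otimes> p \<bowtie> y"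
proof -
  have nc': "\<not> y \<bowtie> x" using nc by metis
  have nxy: "\<not> x \<otimes> y \<bowtie> x" "\<not> x \<otimes> y \<bowtie> y"
    using commute_cancel_left[OF x y x HOL.refl] commute_cancel_right[OF x y y HOL.refl] nc nc' by blast+
  have xy: "x \<otimes> y \<in> carrier G" using x y by simp
  consider "p \<bowtie> x" "p \<bowtie> y" | "p \<bowtie> x" "\<not> p \<bowtie> y" | "\<not> p \<bowtie> x" "p \<bowtie> y" | "\<not> p \<bowtie> x" "\<not> p \<bowtie> y"
    by blast
  then show ?thesis
  proof cases
    case 1
    then have "\<one> \<otimes> p \<bowtie> x \<and> \<one> \<otimes> p \<bowtie> y" using p by (simp only: l_one)
    then show ?thesis by blast
  next
    case 2
    then have "x \<otimes> p \<bowtie> x \<and> x \<otimes> p \<bowtie> y"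
      using commute_mult[OF x p x HOL.refl] non_commute_mult[OF x p y nc] by blast
    then show ?thesis by blast
  next
    case 3
    then have "y \<otimes> p \<bowtie> x \<and> y \<otimes> p \<bowtie> y"
      using commute_mult[OF y p y HOL.refl] non_commute_mult[OF y p x nc'] by blast
    then show ?thesis by blast
  next
    case 4
    then have "x \<otimes> y \<otimes> p \<bowtie> x \<and> x \<otimes> y \<otimes> p \<bowtie> y"
      using non_commute_mult[OF xy p x nxy(1)] non_commute_mult[OF xy p y nxy(2)] by blast
    then show ?thesis by blast
  qed
qed

text \<open>The correcting factor is a word in x and y, so it lies in every subgroup containing
  them. \<open>K\<close> is left arbitrary because it is taken both as the subgroup generated by x
  and y and as the centralizer of an element commuting with them.\<close>

lemma perp_decompose:
  assumes S: "subgroup S G" and x: "x \<in> S" and y: "y \<in> S" and nc: "\<not> x \<bowtie> y" and s: "s \<in> S"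
    and K: "subgroup K G" "x \<in> K" "y \<in> K"
  shows "\<exists>d \<in> K. \<exists>t \<in> perp S x y. s = d \<otimes> t"
proof -
  interpret S: subgroup S G by fact
  interpret K: subgroup K G by fact
  obtain d where d: "d \<in> {\<one>, x, y, x \<otimes> y}" "d \<otimes> s \<bowtie> x" "d \<otimes> s \<bowtie> y"
    using mult_into_centralizers[OF S.mem_carrier[OF x] S.mem_carrier[OF y] nc S.mem_carrier[OF s]] by blast
  have "d \<in> S" "d \<in> K" using d x y K by auto
  then have "s = inv d \<otimes> (d \<otimes> s)" "inv d \<in> K" "d \<otimes> s \<in> perp S x y"
    using s d by (simp_all add: perp_def flip: m_assoc)
  then show ?thesis by blast
qed

text \<open>An element u of the complement commutes with x and y. If it also commutes with the
  complement, then decomposing S with the centralizer of u as \<open>K\<close> shows that it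
  commutes with all of S.\<close>

lemma perp_nondegenerate:
  assumes S: "nondegenerate S" and x: "x \<in> S" and y: "y \<in> S" and nc: "\<not> x \<bowtie> y"
  shows "nondegenerate (perp S x y)"
proof -
  have sS: "subgroup S G" and ZS: "center G \<subseteq> S" using S by (auto simp: nondegenerate_def)
  interpret S: subgroup S G by fact
  have xc: "x \<in> carrier G" "y \<in> carrier G" using x y by auto
  have "perp S x y = S \<inter> (centralizer G x \<inter> centralizer G y)"
    using S.subset by (auto simp: perp_def centralizer_def)
  then have "subgroup (perp S x y) G"
    using sS xc by (simp add: subgroups_Inter_pair centralizer_subgroup)
  moreover have "center G \<subseteq> perp S x y"
    using ZS xc center_commute unfolding perp_def by blast
  moreover have "u \<in> center G" if u: "u \<in> perp S x y" and c: "\<And>s. s \<in> perp S x y \<Longrightarrow> u \<bowtie> s" for u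
  proof -
    have uc: "u \<in> carrier G" "u \<in> S" "u \<bowtie> x" "u \<bowtie> y" using u by (auto simp: perp_def)
    have K: "subgroup (centralizer G u) G" by (rule centralizer_subgroup[OF uc(1)])
    have "u \<bowtie> s" if s: "s \<in> S" for s
    proof -
      have "x \<in> centralizer G u" "y \<in> centralizer G u" using uc xc by (simp_all add: centralizer_def)
      then obtain d t where dt: "d \<in> centralizer G u" "t \<in> perp S x y" "s = d \<otimes> t"
        using perp_decompose[OF sS x y nc s K] by blast
      have t: "t \<in> carrier G" using dt(2) S.subset unfolding perp_def by blast
      have d: "d \<in> carrier G" "d \<bowtie> u" using dt(1) by (simp_all add: centralizer_def)
      show ?thesis using commute_mult[OF d(1) t uc(1) d(2) c[OF dt(2), symmetric]] dt(3) by simp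
    qed
    then show ?thesis using S uc by (auto simp: nondegenerate_def)
  qed
  ultimately show ?thesis by (auto simp: nondegenerate_def)
qed

lemma perp_card:
  assumes S: "subgroup S G" and x: "x \<in> S" and nc: "\<not> x \<bowtie> y"
  shows "card (perp S x y) < card S"
proof (rule psubset_card_mono)
  show "finite S" using fin S by (metis finite_subset subgroup.subset)
  show "perp S x y \<subset> S" using x nc by (auto simp: perp_def)
qed

text \<open>Orthogonal projection: modulo a factor from S, every element centralizes S. A plane x, y
  is split off; d corrects p against the plane, and the induction hypothesis corrects dp against the
  complement by an element that commutes with x and y and so preserves the first correction.\<close>

lemma nondegenerate_complement:
  assumes "nondegenerate S" and p: "p \<in> carrier G"
  shows "\<exists>s \<in> S. \<forall>t \<in> S. s \<otimes> p \<bowtie> t"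
  using assms
proof (induction "card S" arbitrary: S p rule: less_induct)
  case less
  have sS: "subgroup S G" using less.prems by (auto simp: nondegenerate_def)
  interpret S: subgroup S G by fact
  show ?case
  proof (cases "\<exists>x \<in> S. \<exists>y \<in> S. \<not> x \<bowtie> y")
    case False
    then have "S \<subseteq> center G" using less.prems by (auto simp: nondegenerate_def)
    then have "\<one> \<otimes> p \<bowtie> t" if "t \<in> S" for t
      using that less.prems(2) center_commute by (metis l_one subsetD)
    then show ?thesis by (intro bexI[of _ \<one>]) auto
  next
    case True
    then obtain x y where xy: "x \<in> S" "y \<in> S" "\<not> x \<bowtie> y" by blast
    have xc: "x \<in> carrier G" "y \<in> carrier G" using xy by auto
    let ?S = "perp S x y"
    obtain d where d: "d \<in> {\<one>, x, y, x \<otimes> y}" "d \<otimes> p \<bowtie> x" "d \<otimes> p \<bowtie> y"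
      using mult_into_centralizers[OF xc xy(3) less.prems(2)] by blast
    have dS: "d \<in> S" using d xy by auto
    obtain s where s: "s \<in> ?S" "\<And>t. t \<in> ?S \<Longrightarrow> s \<otimes> (d \<otimes> p) \<bowtie> t"
      using less.hyps[OF perp_card[OF sS xy(1,3)] perp_nondegenerate[OF less.prems(1) xy], of "d \<otimes> p"]
        dS less.prems by auto
    have sS': "s \<in> S" "s \<bowtie> x" "s \<bowtie> y" using s by (auto simp: perp_def)
    define q where "q = s \<otimes> (d \<otimes> p)"
    have q: "q \<in> carrier G" using sS' dS less.prems by (auto simp: q_def)
    have qxy: "q \<bowtie> x" "q \<bowtie> y"
      unfolding q_def using sS' dS d less.prems(2) xc by (auto intro!: commute_mult)
    have K: "subgroup (centralizer G q) G" by (rule centralizer_subgroup[OF q])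
    have "q \<bowtie> t" if t: "t \<in> S" for t
    proof -
      have "x \<in> centralizer G q" "y \<in> centralizer G q" using qxy xc by (simp_all add: centralizer_def)
      then obtain e r where er: "e \<in> centralizer G q" "r \<in> perp S x y" "t = e \<otimes> r"
        using perp_decompose[OF sS xy t K] by blast
      have r: "r \<in> carrier G" using er(2) S.subset unfolding perp_def by blast
      have e: "e \<in> carrier G" "e \<bowtie> q" using er(1) by (simp_all add: centralizer_def)
      show ?thesis
        using commute_mult[OF e(1) r q e(2) s(2)[OF er(2), folded q_def, symmetric]] er(3) by simp
    qed
    then show ?thesis
      using sS' dS less.prems(2) by (intro bexI[of _ "s \<otimes> d"]) (auto simp: q_def m_assoc)
  qed
qed

lemma nondegenerate_subgroup: "nondegenerate S \<Longrightarrow> subgroup S G"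
  unfolding nondegenerate_def by (rule conjunct1)

lemma nondegenerate_center: "nondegenerate S \<Longrightarrow> center G \<subseteq> S"
  unfolding nondegenerate_def by (elim conjE)

text \<open>The CA condition in elementwise form. It enters the decomposition lemmas as a premise of
  one conjunct, so that a single construction yields both halves of the theorem.\<close>

definition all_centralizers_abelian where
  "all_centralizers_abelian \<longleftrightarrow>
     (\<forall>x \<in> carrier G - center G. \<forall>u \<in> carrier G. \<forall>v \<in> carrier G. u \<bowtie> x \<longrightarrow> v \<bowtie> x \<longrightarrow> u \<bowtie> v)"

text \<open>Elements of the complement lie in the centralizer of the noncentral x, hence commute
  with each other; nondegeneracy of the complement then makes them central.\<close>

lemma perp_central:
  assumes CA: all_centralizers_abelian and S: "nondegenerate S"
    and x: "x \<in> S" "y \<in> S" "\<not> x \<bowtie> y"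
  shows "perp S x y \<subseteq> center G"
proof
  fix u assume u: "u \<in> perp S x y"
  have xc: "x \<in> carrier G" "y \<in> carrier G"
    by (rule subgroup.mem_carrier[OF nondegenerate_subgroup[OF S]]; fact)+
  have "x \<notin> center G" using x(3) center_commute xc by blast
  then have *: "v \<bowtie> w" if "v \<in> carrier G" "w \<in> carrier G" "v \<bowtie> x" "w \<bowtie> x" for v w
    using CA xc(1) that unfolding all_centralizers_abelian_def by blast
  have N: "nondegenerate (perp S x y)" by (rule perp_nondegenerate[OF S x])
  have car: "v \<in> carrier G" if "v \<in> perp S x y" for v
    by (rule subgroup.mem_carrier[OF nondegenerate_subgroup[OF N] that])
  have "u \<bowtie> v" if "v \<in> perp S x y" for v
  proof (rule *)
    show "u \<bowtie> x" "v \<bowtie> x" using u that unfolding perp_def by blast+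
  qed (use u that car in auto)
  then show "u \<in> center G" using N u unfolding nondegenerate_def by blast
qed

section \<open>Splitting off dihedral factors\<close>

lemma case_ab_closed: "subgroup S G \<Longrightarrow> x \<in> S \<Longrightarrow> y \<in> S \<Longrightarrow> case_ab x y g \<in> S"
  by (cases g) auto

text \<open>The subgroup generated by x and y, written as the set of values of words because the
  recognition lemmas speak of it in this form.\<close>

lemma range_word_value_pair:
  assumes S: "subgroup S G" and x: "x \<in> S" and y: "y \<in> S"
  shows "subgroup (range (word_value G (case_ab x y))) G"
    and "range (word_value G (case_ab x y)) \<subseteq> S"
    and "x \<in> range (word_value G (case_ab x y))" "y \<in> range (word_value G (case_ab x y))"
    and "u \<in> range (word_value G (case_ab x y)) \<Longrightarrow> v \<in> perp S x y \<Longrightarrow> u \<bowtie> v"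
proof -
  let ?f = "case_ab x y"
  have fS: "?f g \<in> S" for g by (rule case_ab_closed[OF assms])
  then have f: "?f g \<in> carrier G" for g using subgroup.mem_carrier[OF S] by blast
  show "subgroup (range (word_value G ?f)) G" by (rule subgroup_range_word_value) (rule f)
  show "range (word_value G ?f) \<subseteq> S" using word_value_in_subgroup[OF S, of ?f] fS by blast
  have "word_value G ?f wa = x" "word_value G ?f wb = y" by (simp_all add: word_value_gen[of ?f, OF f])
  then show "x \<in> range (word_value G ?f)" "y \<in> range (word_value G ?f)" by (metis rangeI)+
  assume u: "u \<in> range (word_value G ?f)" and v: "v \<in> perp S x y"
  have vc: "v \<in> carrier G" using v subgroup.mem_carrier[OF S] unfolding perp_def by blast
  have "?f g \<in> centralizer G v" for g
    using f[of g] v unfolding perp_def centralizer_def by (cases g) auto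
  then have "range (word_value G ?f) \<subseteq> centralizer G v"
    using word_value_in_subgroup[OF centralizer_subgroup[OF vc], of ?f] by blast
  then show "u \<bowtie> v" using u unfolding centralizer_def by blast
qed

text \<open>Nondegeneracy gives a partner of x, and a central factor brings its square into {1, c}.
  If the square is c, then y is replaced by xy, whose square is x^2 y^2 c = c c = 1.\<close>

lemma dihedral_factor:
  assumes S: "nondegenerate S" and sq: "\<And>u. u \<in> S \<Longrightarrow> \<exists>v \<in> center G. (u \<otimes> v) \<otimes> (u \<otimes> v) \<in> {\<one>, c}"
    and x: "x \<in> S" "x \<otimes> x = \<one>" "x \<notin> center G"
  shows "\<exists>y \<in> S. y \<otimes> y = \<one> \<and> \<not> x \<bowtie> y"
proof -
  have sS: "subgroup S G" by (rule nondegenerate_subgroup[OF S])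
  interpret S: subgroup S G by fact
  obtain y0 where y0: "y0 \<in> S" "\<not> x \<bowtie> y0"
    using S x unfolding nondegenerate_def by blast
  obtain v where v: "v \<in> center G" "(y0 \<otimes> v) \<otimes> (y0 \<otimes> v) \<in> {\<one>, c}" using sq y0 by blast
  define y where "y = y0 \<otimes> v"
  have y: "y \<in> S" using y0 v S unfolding y_def nondegenerate_def by blast
  have xc: "x \<in> carrier G" and yc: "y \<in> carrier G" and vc: "v \<in> carrier G" and y0c: "y0 \<in> carrier G"
    using x y y0 v center_closed by auto
  have nc: "\<not> x \<bowtie> y"
    using commute_cancel_right[OF y0c vc xc center_commute[OF v(1) xc]] y0(2) unfolding y_def by metis
  show ?thesis
  proof (cases "y \<otimes> y = \<one>")
    case True
    then show ?thesis using y nc by blast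
  next
    case False
    then have "y \<otimes> y = c" using v(2) unfolding y_def by blast
    then have "(x \<otimes> y) \<otimes> (x \<otimes> y) = \<one>"
      using x(2) by (simp add: square_mult_non_commute[OF xc yc nc] c_involution)
    moreover have "\<not> x \<bowtie> x \<otimes> y"
      using commute_cancel_left[OF xc yc xc HOL.refl] nc by metis
    ultimately show ?thesis using x(1) y by blast
  qed
qed

lemma dihedral_subgroup:
  assumes x: "x \<in> carrier G" "x \<otimes> x = \<one>" and y: "y \<in> carrier G" "y \<otimes> y = \<one>" and nc: "\<not> x \<bowtie> y"
  shows "G\<lparr>carrier := range (word_value G (case_ab x y))\<rparr> \<cong> Q_group 1 1"
proof (rule Q_1_1_iso)
  have "\<not> y \<bowtie> x" using nc by metis
  then show "x \<otimes> y = y \<otimes> x \<otimes> c" by (rule non_commute[OF y(1) x(1)])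
qed (use assms in \<open>simp_all add: c_ne c_involution c_commute\<close>)

lemma commutator_in_pair:
  assumes K: "subgroup K G" "x \<in> K" "y \<in> K" and nc: "\<not> x \<bowtie> y"
  shows "c \<in> K"
proof -
  interpret K: subgroup K G by fact
  have "y \<otimes> x = x \<otimes> y \<otimes> c" using K nc by (intro non_commute) auto
  then have "inv (x \<otimes> y) \<otimes> (y \<otimes> x) = c" using K by (simp add: inv_solve_left')
  moreover have "inv (x \<otimes> y) \<otimes> (y \<otimes> x) \<in> K" using K(2,3) by blast
  ultimately show ?thesis by simp
qed

lemma subset_set_mult_left:
  assumes L: "subgroup L G" and K: "K \<subseteq> carrier G"
  shows "K \<subseteq> K <#> L"
proof
  fix x assume x: "x \<in> K"
  then have "x = x \<otimes> \<one>" using K by auto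
  then show "x \<in> K <#> L" using x subgroup.one_closed[OF L] unfolding set_mult_def by blast
qed

text \<open>The last two clauses are bookkeeping: c in F lets F absorb a center of order two, and
  noncentrality of F rules out further factors in a CA-group.\<close>

definition dihedral_product where
  "dihedral_product F e \<longleftrightarrow> subgroup F G \<and>
     central_decomposition (G\<lparr>carrier := F\<rparr>) (replicate e (Q_group 1 1)) \<and>
     (e = 0 \<longrightarrow> F = {\<one>}) \<and> (e > 0 \<longrightarrow> c \<in> F \<and> \<not> F \<subseteq> center G)"

text \<open>In the language of quadratic forms, F is the hyperbolic part and T an anisotropic
  remainder, in which no noncentral involution is left.\<close>

definition dihedral_splitting where
  "dihedral_splitting S T F e \<longleftrightarrow> nondegenerate T \<and> dihedral_product F e \<and> T <#> F = S \<and>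
     T \<subseteq> S \<and> F \<subseteq> S \<and> (\<forall>t \<in> T. \<forall>f \<in> F. t \<bowtie> f) \<and> (\<forall>u \<in> T. u \<otimes> u = \<one> \<longrightarrow> u \<in> center G) \<and>
     (all_centralizers_abelian \<longrightarrow> e \<le> 1)"

text \<open>Each noncentral involution x has a partner y; the two generate a dihedral factor, and
  the induction goes on in \<open>perp S x y\<close>, which is smaller since it misses x. The
  adjustment hypothesis passes to subsets, so it survives the descent.\<close>

lemma split_dihedral:
  assumes "nondegenerate S" and "\<And>u. u \<in> S \<Longrightarrow> \<exists>v \<in> center G. (u \<otimes> v) \<otimes> (u \<otimes> v) \<in> {\<one>, c}"
  shows "\<exists>T F e. dihedral_splitting S T F e"
  using assms
proof (induction "card S" arbitrary: S rule: less_induct)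
  case less
  have sS: "subgroup S G" by (rule nondegenerate_subgroup[OF less.prems(1)])
  interpret S: subgroup S G by fact
  show ?case
  proof (cases "\<forall>u \<in> S. u \<otimes> u = \<one> \<longrightarrow> u \<in> center G")
    case True
    have 1: "subgroup {\<one>} G" by (rule triv_subgroup)
    have "dihedral_product {\<one>} 0"
      by (simp add: dihedral_product_def 1 central_decomposition_Nil)
    moreover have "S <#> {\<one>} = S" by (force simp: set_mult_def)
    moreover have "t \<bowtie> f" if "t \<in> S" "f \<in> {\<one>}" for t f using that by simp
    ultimately show ?thesis using True less.prems(1) S.one_closed
      by (intro exI[of _ S] exI[of _ "{\<one>}"] exI[of _ 0]) (simp add: dihedral_splitting_def)
  next
    case False
    then obtain x where x: "x \<in> S" "x \<otimes> x = \<one>" "x \<notin> center G" by blast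
    obtain y where y: "y \<in> S" "y \<otimes> y = \<one>" "\<not> x \<bowtie> y"
      using dihedral_factor[OF less.prems x] by blast
    define D where "D = range (word_value G (case_ab x y))"
    note D = range_word_value_pair[OF sS x(1) y(1), folded D_def]
    let ?S = "perp S x y"
    have NS: "nondegenerate ?S" by (rule perp_nondegenerate[OF less.prems(1) x(1) y(1,3)])
    have SS: "?S \<subseteq> S" by (auto simp: perp_def)
    have "\<exists>T F e. dihedral_splitting ?S T F e"
      by (rule less.hyps[OF perp_card[OF sS x(1) y(3)] NS]) (use less.prems(2) SS in blast)
    then obtain T F e where split: "dihedral_splitting ?S T F e" by blast
    note split' = split[unfolded dihedral_splitting_def]
    have T: "nondegenerate T" "T \<subseteq> ?S" "\<forall>u \<in> T. u \<otimes> u = \<one> \<longrightarrow> u \<in> center G"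
      using split' by - (elim conjE, assumption)+
    have F: "dihedral_product F e" "F \<subseteq> ?S" and TF: "T <#> F = ?S"
      using split' by - (elim conjE, assumption)+
    have commT: "\<forall>t \<in> T. \<forall>f \<in> F. t \<bowtie> f"
      using split' by - (elim conjE, assumption)
    note comm = bspec[OF bspec[OF commT]]
    have sT: "subgroup T G" by (rule nondegenerate_subgroup[OF T(1)])
    have sF: "subgroup F G" using F(1) by (simp add: dihedral_product_def)
    have DF: "d \<bowtie> f" if "d \<in> D" "f \<in> F" for d f
      by (rule D(5)[OF that(1) subsetD[OF F(2) that(2)]])
    let ?F = "D <#> F"
    have FS: "?F \<subseteq> S" using D(2) F(2) SS unfolding set_mult_def by blast
    have xF: "x \<in> ?F" using subset_set_mult_left[OF sF, of D] D(2,3) S.subset by blast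
    have "dihedral_product ?F (Suc e)"
      unfolding dihedral_product_def
    proof (intro conjI impI)
      show "subgroup ?F G" by (rule subgroup_set_mult_commute[OF D(1) sF DF])
      show "central_decomposition (G\<lparr>carrier := ?F\<rparr>) (replicate (Suc e) (Q_group 1 1))"
        unfolding replicate_Suc
      proof (rule central_decomposition_Cons[OF D(1) sF DF])
        show "G\<lparr>carrier := D\<rparr> \<cong> Q_group 1 1"
          unfolding D_def by (rule dihedral_subgroup) (use x(1,2) y in auto)
        show "central_decomposition (G\<lparr>carrier := F\<rparr>) (replicate e (Q_group 1 1))"
          using F(1) unfolding dihedral_product_def by blast
      qed
      show "\<not> ?F \<subseteq> center G" using xF x by blast
      show "c \<in> ?F"
        using subset_set_mult_left[OF sF, of D] commutator_in_pair[OF D(1,3,4) y(3)] D(2) S.subset by blast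
    qed simp
    moreover have "\<forall>t \<in> T. \<forall>f \<in> ?F. t \<bowtie> f"
    proof (intro ballI)
      fix t f assume t: "t \<in> T" and f: "f \<in> ?F"
      obtain d g where dg: "f = d \<otimes> g" "d \<in> D" "g \<in> F" using f unfolding set_mult_def by blast
      have "d \<otimes> g \<bowtie> t"
      proof (rule commute_mult)
        show "d \<bowtie> t" by (rule D(5)[OF dg(2) subsetD[OF T(2) t]])
        show "g \<bowtie> t" using comm[OF t dg(3)] by (rule HOL.sym)
      qed (use dg(2,3) t D(2) F(2) T(2) SS S.subset in blast)+
      then show "t \<bowtie> f" using dg(1) by simp
    qed
    moreover have "T <#> ?F = S"
    proof
      show "T <#> ?F \<subseteq> S" using T(2) SS FS unfolding set_mult_def by blast
      show "S \<subseteq> T <#> ?F"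
      proof
        fix s assume "s \<in> S"
        then obtain d p where dp: "d \<in> D" "p \<in> ?S" "s = d \<otimes> p"
          using perp_decompose[OF sS x(1) y(1,3) _ D(1,3,4)] by blast
        obtain t f where tf: "t \<in> T" "f \<in> F" "p = t \<otimes> f" using dp(2) TF unfolding set_mult_def by blast
        have car: "d \<in> carrier G" "t \<in> carrier G" "f \<in> carrier G"
          using dp(1) tf(1,2) D(2) T(2) F(2) SS S.subset by blast+
        have "s = (d \<otimes> t) \<otimes> f" using dp tf car by (simp add: m_assoc)
        also have "d \<otimes> t = t \<otimes> d" by (rule D(5)[OF dp(1) subsetD[OF T(2) tf(1)]])
        also have "t \<otimes> d \<otimes> f = t \<otimes> (d \<otimes> f)" using car by (simp add: m_assoc)
        finally show "s \<in> T <#> ?F" using tf dp unfolding set_mult_def by blast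
      qed
    qed
    \<comment> \<open>Here F lies in the complement of x and y, which is central in a CA-group, so
      no dihedral factor was split off before.\<close>
    moreover have "all_centralizers_abelian \<longrightarrow> Suc e \<le> 1"
    proof
      assume all_centralizers_abelian
      from perp_central[OF this less.prems(1) x(1) y(1,3)] F(2) have "F \<subseteq> center G" by blast
      then show "Suc e \<le> 1" using F(1) by (auto simp: dihedral_product_def)
    qed
    moreover have "T \<subseteq> S" using T(2) SS by blast
    ultimately have "dihedral_splitting S T ?F (Suc e)"
      unfolding dihedral_splitting_def using T(1,3) FS by (intro conjI)
    then show ?thesis by blast
  qed
qed

lemma dihedral_splittingD:
  assumes "dihedral_splitting S T F e"
  shows "nondegenerate T" "dihedral_product F e" "T <#> F = S" "T \<subseteq> S" "F \<subseteq> S"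
    "\<forall>t \<in> T. \<forall>f \<in> F. t \<bowtie> f" "\<forall>u \<in> T. u \<otimes> u = \<one> \<longrightarrow> u \<in> center G"
    "all_centralizers_abelian \<longrightarrow> e \<le> 1"
  using assms unfolding dihedral_splitting_def by - (elim conjE, assumption)+

lemma nondegenerate_carrier: "nondegenerate (carrier G)"
  unfolding nondegenerate_def
proof (intro conjI ballI impI)
  show "subgroup (carrier G) G" by (rule subgroup_self)
  show "center G \<subseteq> carrier G" using center_closed by blast
  fix u assume "u \<in> carrier G" "\<forall>s \<in> carrier G. u \<bowtie> s"
  then show "u \<in> center G" unfolding center_def by blast
qed

lemma central_decomposition_mult:
  assumes K: "subgroup K G" and comm: "\<And>x y. x \<in> K \<Longrightarrow> y \<in> F \<Longrightarrow> x \<bowtie> y"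
    and F: "dihedral_product F e" and KF: "K <#> F = carrier G" and H: "G\<lparr>carrier := K\<rparr> \<cong> H"
  shows "central_decomposition G (H # replicate e (Q_group 1 1))"
proof -
  have "subgroup F G" "central_decomposition (G\<lparr>carrier := F\<rparr>) (replicate e (Q_group 1 1))"
    using F unfolding dihedral_product_def by blast+
  from central_decomposition_Cons[OF K this(1) comm H this(2)] show ?thesis
    by (simp add: KF)
qed

lemma dihedral_product_not_central: "dihedral_product F e \<Longrightarrow> F \<subseteq> center G \<Longrightarrow> e = 0"
  unfolding dihedral_product_def by blast

lemma set_mult_center: "T \<subseteq> center G \<Longrightarrow> F = {\<one>} \<Longrightarrow> T <#> F \<subseteq> center G"
  using center_closed by (force simp: set_mult_def)

section \<open>Squares modulo squares of the center; vanishing functional\<close>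

text \<open>It says that x^2 is a square in the center. For k > 1 these elements form the kernel of
  the functional induced by squaring.\<close>

definition even_square where "even_square x \<longleftrightarrow> (\<exists>i::int. x \<otimes> x = z [^] (2 * i))"

text \<open>If x^2 = z^(2i), the central factor z^(-i) cancels the square.\<close>

lemma even_square_adjust:
  assumes x: "x \<in> carrier G" and "even_square x"
  shows "\<exists>v \<in> center G. (x \<otimes> v) \<otimes> (x \<otimes> v) = \<one>"
proof -
  obtain i :: int where i: "x \<otimes> x = z [^] (2 * i)" using assms by (auto simp: even_square_def)
  define v where "v = z [^] (- i)"
  have v: "v \<in> center G" by (simp add: v_def pow_z_center)
  have vc: "v \<in> carrier G" using v by (rule center_closed)
  have "(x \<otimes> v) \<otimes> (x \<otimes> v) = (x \<otimes> x) \<otimes> (v \<otimes> v)"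
    by (rule square_mult_commute[OF x vc center_commute[OF v x, symmetric]])
  also have "\<dots> = z [^] (2 * i + (- i + - i))" using z by (simp only: i v_def int_pow_mult)
  also have "\<dots> = \<one>" by simp
  finally show ?thesis using v by blast
qed

text \<open>A central factor turns any element of T into one of square one, which is central by
  assumption; so the element was central already.\<close>

lemma even_square_subset_center:
  assumes T: "nondegenerate T" and inv: "\<forall>u \<in> T. u \<otimes> u = \<one> \<longrightarrow> u \<in> center G"
    and even: "\<And>u. u \<in> T \<Longrightarrow> even_square u"
  shows "T = center G"
proof
  show "center G \<subseteq> T" by (rule nondegenerate_center[OF T])
  interpret T: subgroup T G by (rule nondegenerate_subgroup[OF T])
  interpret Z: subgroup "center G" G by (rule center_subgroup)
  show "T \<subseteq> center G"
  proof
    fix u assume u: "u \<in> T"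
    obtain v where v: "v \<in> center G" "(u \<otimes> v) \<otimes> (u \<otimes> v) = \<one>"
      using even_square_adjust[OF T.mem_carrier[OF u] even[OF u]] by blast
    have "u \<otimes> v \<in> T" using u v(1) nondegenerate_center[OF T] by blast
    then have "u \<otimes> v \<in> center G" using inv v(2) by blast
    then have "u \<otimes> v \<otimes> inv v \<in> center G" using v(1) by blast
    then show "u \<in> center G" using u v(1) by (simp add: m_assoc)
  qed
qed

lemma decomposition_even:
  assumes k2: "k \<ge> 2" and nonab: "\<not> carrier G \<subseteq> center G" and even: "\<And>x. x \<in> carrier G \<Longrightarrow> even_square x"
  shows "\<exists>e \<ge> 1. central_decomposition G (Q_group k 0 # replicate e (Q_group 1 1)) \<and>
    (all_centralizers_abelian \<longrightarrow> e = 1)"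
proof -
  have "\<exists>T F e. dihedral_splitting (carrier G) T F e"
    by (rule split_dihedral[OF nondegenerate_carrier]) (use even even_square_adjust in blast)
  then obtain T F e where "dihedral_splitting (carrier G) T F e" by blast
  note D = dihedral_splittingD[OF this]
  have T: "T = center G" by (rule even_square_subset_center[OF D(1,7)]) (use even D(4) in blast)
  \<comment> \<open>Without a dihedral factor the whole group would equal T, the center.\<close>
  have "e \<noteq> 0"
  proof
    assume "e = 0"
    then have "F = {\<one>}" using D(2) unfolding dihedral_product_def by blast
    then show False using set_mult_center[of T F] T D(3) nonab by simp
  qed
  moreover have "central_decomposition G (Q_group k 0 # replicate e (Q_group 1 1))"
  proof (rule central_decomposition_mult[OF nondegenerate_subgroup[OF D(1)] bspec[OF bspec[OF D(6)]] D(2,3)])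
    show "G\<lparr>carrier := T\<rparr> \<cong> Q_group k 0"
      unfolding T center_eq by (rule Q_n_0_iso[OF z ord_z])
  qed
  ultimately show ?thesis using D(8) by (intro exI[of _ e]) auto
qed

section \<open>Center of order two\<close>

lemma center_k1:
  assumes "k = 1" "u \<in> center G"
  shows "u = \<one> \<or> u = c"
proof -
  obtain i :: int where i: "u = z [^] i" using assms(2) center_eq by auto
  have "u \<otimes> u = z [^] (i + i)" unfolding i using z by (simp only: int_pow_mult)
  also have "\<dots> = z [^] (0::int)" unfolding pow_z_eq using assms(1) by simp
  finally show ?thesis using central_involution[OF assms(2)] by simp
qed

text \<open>All noncentral elements of T have square c. A noncentral t orthogonal to x and y would
  give (tx)^2 = c c = 1, so tx would be central, and since t commutes with y, so would x. Thus the
  complement of the plane is just the center {1, c}, which already lies in the quaternion group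
  generated by x and y.\<close>

lemma quaternion_pair:
  assumes k1: "k = 1" and T: "nondegenerate T" and inv: "\<forall>u \<in> T. u \<otimes> u = \<one> \<longrightarrow> u \<in> center G"
    and x: "x \<in> T" and y: "y \<in> T" and nc: "\<not> x \<bowtie> y"
  shows "T = range (word_value G (case_ab x y))" and "G\<lparr>carrier := T\<rparr> \<cong> R_group 1"
proof -
  let ?K = "range (word_value G (case_ab x y))"
  have sT: "subgroup T G" by (rule nondegenerate_subgroup[OF T])
  interpret T: subgroup T G by fact
  have xc: "x \<in> carrier G" and yc: "y \<in> carrier G" using x y by auto
  note K = range_word_value_pair[OF sT x y]
  interpret K: subgroup ?K G by (rule K(1))
  have sq: "u \<otimes> u = c" if "u \<in> T" "u \<notin> center G" for u
    using center_k1[OF k1 square_central[OF T.mem_carrier[OF that(1)]]] inv that by blast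
  have nz: "x \<notin> center G" "y \<notin> center G"
    using nc center_commute[of x y] center_commute[of y x] xc yc by auto
  have cK: "c \<in> ?K" by (rule commutator_in_pair[OF K(1,3,4) nc])
  have perp: "perp T x y \<subseteq> ?K"
  proof
    fix t assume t: "t \<in> perp T x y"
    then have tT: "t \<in> T" and tx: "t \<bowtie> x" and ty: "t \<bowtie> y" unfolding perp_def by blast+
    have tc: "t \<in> carrier G" using tT by auto
    have "t \<in> center G"
    proof (rule ccontr)
      assume tn: "t \<notin> center G"
      have "(t \<otimes> x) \<otimes> (t \<otimes> x) = (t \<otimes> t) \<otimes> (x \<otimes> x)" by (rule square_mult_commute[OF tc xc tx])
      also have "\<dots> = \<one>" using sq[OF tT tn] sq[OF x nz(1)] c_involution by simp
      finally have "t \<otimes> x \<in> center G" using inv tT x by blast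
      then have "t \<otimes> x \<bowtie> y" using center_commute yc by blast
      then have "x \<bowtie> y" by (rule commute_cancel_left[OF tc xc yc ty])
      then show False using nc by blast
    qed
    then show "t \<in> ?K" using center_k1[OF k1] cK K.one_closed by blast
  qed
  show TK: "T = ?K"
  proof
    show "T \<subseteq> ?K"
    proof
      fix t assume "t \<in> T"
      then obtain d p where "d \<in> ?K" "p \<in> perp T x y" "t = d \<otimes> p"
        using perp_decompose[OF sT x y nc _ K(1,3,4)] by blast
      then show "t \<in> ?K" using perp by blast
    qed
  qed (rule K(2))
  have nc': "\<not> y \<bowtie> x" using nc by metis
  have "G\<lparr>carrier := ?K\<rparr> \<cong> R_group 1"
    by (rule R_1_iso[OF xc yc c_closed c_ne c_involution c_commute[OF xc] c_commute[OF yc] non_commute[OF yc xc nc']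
      sq[OF x nz(1)] sq[OF y nz(2)]])
  then show "G\<lparr>carrier := T\<rparr> \<cong> R_group 1" by (simp only: TK)
qed

lemma decomposition_k1:
  assumes k1: "k = 1" and nonab: "\<not> carrier G \<subseteq> center G"
  shows "(\<exists>e \<ge> 1. central_decomposition G (replicate e (Q_group 1 1)) \<and> (all_centralizers_abelian \<longrightarrow> e = 1)) \<or>
    (\<exists>e. central_decomposition G (R_group 1 # replicate e (Q_group 1 1)) \<and> (all_centralizers_abelian \<longrightarrow> e = 0))"
proof -
  have "\<exists>T F e. dihedral_splitting (carrier G) T F e"
  proof (rule split_dihedral[OF nondegenerate_carrier])
    fix u assume u: "u \<in> carrier G"
    have "\<one> \<in> center G" by (rule subgroup.one_closed[OF center_subgroup])
    moreover have "(u \<otimes> \<one>) \<otimes> (u \<otimes> \<one>) \<in> {\<one>, c}"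
      using center_k1[OF k1 square_central[OF u]] u by simp
    ultimately show "\<exists>v \<in> center G. (u \<otimes> v) \<otimes> (u \<otimes> v) \<in> {\<one>, c}" by blast
  qed
  then obtain T F e where "dihedral_splitting (carrier G) T F e" by blast
  note D = dihedral_splittingD[OF this]
  note sT = nondegenerate_subgroup[OF D(1)]
  have sF: "subgroup F G" and cdF: "central_decomposition (G\<lparr>carrier := F\<rparr>) (replicate e (Q_group 1 1))"
    using D(2) unfolding dihedral_product_def by blast+
  interpret F: subgroup F G by fact
  show ?thesis
  proof (cases "T \<subseteq> center G")
    case True
    have e: "e \<noteq> 0"
    proof
      assume "e = 0"
      then have "F = {\<one>}" using D(2) unfolding dihedral_product_def by blast
      then show False using set_mult_center[of T F] True D(3) nonab by simp
    qed
    \<comment> \<open>The remainder T = {1, c} is absorbed by any dihedral factor, which is why the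
      center does not occur as a factor of its own.\<close>
    then have "c \<in> F" using D(2) unfolding dihedral_product_def by blast
    then have "T \<subseteq> F" using center_k1[OF k1] True F.one_closed by blast
    then have "T <#> F \<subseteq> F" unfolding set_mult_def by blast
    then have "F = carrier G" using D(3) F.subset by blast
    then have "central_decomposition G (replicate e (Q_group 1 1))" using cdF by simp
    then show ?thesis using e D(8) by (intro disjI1 exI[of _ e]) auto
  next
    case False
    then obtain x y where xy: "x \<in> T" "y \<in> T" "\<not> x \<bowtie> y"
      using D(1) unfolding nondegenerate_def by blast
    have "central_decomposition G (R_group 1 # replicate e (Q_group 1 1))"
      by (rule central_decomposition_mult[OF sT bspec[OF bspec[OF D(6)]] D(2,3) quaternion_pair(2)[OF k1 D(1,7) xy]])
    \<comment> \<open>F commutes with the noncommuting pair x, y of T, so in a CA-group it is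
      central.\<close>
    moreover have "e = 0" if CA: all_centralizers_abelian
    proof -
      have "x \<in> carrier G" "y \<in> carrier G" using xy D(4) by blast+
      have "F \<subseteq> perp (carrier G) x y"
      proof
        fix f assume f: "f \<in> F"
        note this = bspec[OF bspec[OF D(6) xy(1)] f, symmetric] bspec[OF bspec[OF D(6) xy(2)] f, symmetric]
        with f F.subset show "f \<in> perp (carrier G) x y" unfolding perp_def by blast
      qed
      then have "F \<subseteq> center G"
        using perp_central[OF CA nondegenerate_carrier \<open>x \<in> carrier G\<close> \<open>y \<in> carrier G\<close> xy(3)] by blast
      then show ?thesis by (rule dihedral_product_not_central[OF D(2)])
    qed
    ultimately show ?thesis by blast
  qed
qed

section \<open>Center of order at least four: nonvanishing functional\<close>

lemma square_pow_z:
  assumes "x \<in> carrier G"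
  obtains i :: int where "x \<otimes> x = z [^] i"
  using square_central[OF assms] center_eq by blast

lemma odd_square:
  assumes "x \<in> carrier G" "\<not> even_square x"
  obtains i :: int where "x \<otimes> x = z [^] i" "odd i"
proof -
  obtain i :: int where i: "x \<otimes> x = z [^] i" using square_pow_z[OF assms(1)] .
  then have "odd i" using assms(2) unfolding even_square_def by (auto elim!: evenE)
  then show ?thesis using that i by blast
qed

text \<open>The exponent of z is determined modulo 2^k, and k is positive, so its parity is well
  defined.\<close>

lemma even_square_iff:
  assumes "x \<otimes> x = z [^] (i::int)"
  shows "even_square x \<longleftrightarrow> even i"
proof
  assume "even_square x"
  then obtain j :: int where "z [^] i = z [^] (2 * j)" using assms unfolding even_square_def by auto
  then have "2 * 2 ^ (k - 1) dvd i - 2 * j" unfolding pow_z_eq by (simp only: two_pow_k)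
  then have "even (i - 2 * j)" by (rule dvd_mult_left)
  then show "even i" by simp
qed (auto simp: even_square_def assms elim!: evenE)

text \<open>A commutator c entering the square of xy shifts the exponent by 2^(k-1), which is even
  once k is at least 2. So the parity of the exponent is additive.\<close>

lemma even_square_mult:
  assumes k2: "k \<ge> 2" and x: "x \<in> carrier G" and y: "y \<in> carrier G"
  shows "even_square (x \<otimes> y) \<longleftrightarrow> (even_square x \<longleftrightarrow> even_square y)"
proof -
  obtain i j :: int where i: "x \<otimes> x = z [^] i" and j: "y \<otimes> y = z [^] j"
    using square_pow_z[OF x] square_pow_z[OF y] by metis
  have "\<exists>l. even l \<and> (x \<otimes> y) \<otimes> (x \<otimes> y) = z [^] (i + j + l)"
  proof (cases "x \<bowtie> y")
    case True
    then have "(x \<otimes> y) \<otimes> (x \<otimes> y) = z [^] (i + j + 0)"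
      using square_mult_commute[OF x y True] z by (simp add: i j int_pow_mult)
    then show ?thesis using dvd_0_right by blast
  next
    case False
    have "(x \<otimes> y) \<otimes> (x \<otimes> y) = z [^] (i + j + 2 ^ (k - 1))"
      using square_mult_non_commute[OF x y False] z by (simp add: i j c_def int_pow_mult)
    moreover have "even ((2::int) ^ (k - 1))" using k2 by simp
    ultimately show ?thesis by blast
  qed
  then obtain l where l: "even l" "(x \<otimes> y) \<otimes> (x \<otimes> y) = z [^] (i + j + l)" by blast
  show ?thesis
    unfolding even_square_iff[OF i] even_square_iff[OF j] even_square_iff[OF l(2)] using l(1) by simp
qed

lemma even_square_center: "u \<in> center G \<Longrightarrow> even_square u"
  using z by (auto simp: center_eq even_square_def simp flip: int_pow_mult mult_2)

lemma even_square_subgroup: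
  assumes k2: "k \<ge> 2"
  shows "subgroup {x \<in> carrier G. even_square x} G"
proof (rule subgroupI)
  have "even_square \<one>" by (rule even_square_center[OF subgroup.one_closed[OF center_subgroup]])
  then show "{x \<in> carrier G. even_square x} \<noteq> {}" by blast
  show "inv a \<in> {x \<in> carrier G. even_square x}" if "a \<in> {x \<in> carrier G. even_square x}" for a
    using even_square_mult[OF k2, of a "inv a"] that \<open>even_square \<one>\<close> by simp
  show "a \<otimes> b \<in> {x \<in> carrier G. even_square x}"
    if "a \<in> {x \<in> carrier G. even_square x}" "b \<in> {x \<in> carrier G. even_square x}" for a b
    using even_square_mult[OF k2, of a b] that by simp
qed blast

text \<open>
  The elements with even square form a subgroup of index two. Were it nondegenerate, an element
  outside it could be moved into the center by multiplying with an element inside.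
\<close>

lemma odd_square_dual:
  assumes k2: "k \<ge> 2" and w: "w \<in> carrier G" "\<not> even_square w"
  obtains b where "b \<in> carrier G" "b \<otimes> b = \<one>" "\<not> b \<bowtie> w"
    "\<And>x. x \<in> carrier G \<Longrightarrow> even_square x \<Longrightarrow> b \<bowtie> x"
proof -
  define L where "L = {x \<in> carrier G. even_square x}"
  have sL: "subgroup L G" unfolding L_def by (rule even_square_subgroup[OF k2])
  interpret L: subgroup L G by fact
  have ZL: "center G \<subseteq> L" unfolding L_def using even_square_center center_closed by blast
  \<comment> \<open>Together L and w generate G: outside L, the product pw lies in L. Hence whatever
    commutes with L and w is central.\<close>
  have all: "q \<in> center G" if q: "q \<in> carrier G" "\<And>l. l \<in> L \<Longrightarrow> q \<bowtie> l" "q \<bowtie> w" for q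
  proof (rule centerI[OF q(1)])
    fix p assume p: "p \<in> carrier G"
    show "q \<bowtie> p"
    proof (cases "p \<in> L")
      case False
      then have "\<not> even_square p" using p unfolding L_def by blast
      then have "p \<otimes> w \<in> L" unfolding L_def using even_square_mult[OF k2 p w(1)] w p by simp
      from q(2)[OF this, symmetric] q(3)[symmetric] show ?thesis
        using commute_cancel_right[OF p w(1) q(1)] by (metis (no_types))
    qed (rule q(2))
  qed
  have "\<not> nondegenerate L"
  proof
    assume "nondegenerate L"
    from nondegenerate_complement[OF this w(1)]
    obtain s where s: "s \<in> L" "\<forall>t \<in> L. s \<otimes> w \<bowtie> t" by blast
    have sc: "s \<in> carrier G" by (rule L.mem_carrier[OF s(1)])
    define q where "q = s \<otimes> w"
    have q: "q \<in> carrier G" "\<And>l. l \<in> L \<Longrightarrow> q \<bowtie> l"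
      unfolding q_def by (rule m_closed[OF sc w(1)]) (rule bspec[OF s(2)])
    have "w \<bowtie> q"
      by (rule commute_cancel_left[OF sc w(1) q(1) q(2)[OF s(1), symmetric]]) (simp add: q_def)
    have "q \<in> center G"
    proof (rule all[OF q(1)])
      show "q \<bowtie> l" if "l \<in> L" for l by (rule q(2)[OF that])
      show "q \<bowtie> w" using \<open>w \<bowtie> q\<close> by (rule HOL.sym)
    qed
    then have "q \<in> L" using ZL by blast
    then have "inv s \<otimes> q \<in> L" using s(1) by blast
    then have "w \<in> L" using sc w(1) by (simp add: q_def flip: m_assoc)
    then show False using w(2) unfolding L_def by blast
  qed
  \<comment> \<open>A noncentral element of the radical of L. Being in L it has an even square, so a
    central factor turns it into the required involution.\<close>
  then obtain b0 where b0: "b0 \<in> L" "b0 \<notin> center G" "\<forall>l \<in> L. b0 \<bowtie> l"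
    using sL ZL unfolding nondegenerate_def by blast
  have b0c: "b0 \<in> carrier G" "even_square b0" using b0(1) unfolding L_def by blast+
  obtain v where v: "v \<in> center G" "(b0 \<otimes> v) \<otimes> (b0 \<otimes> v) = \<one>"
    using even_square_adjust[OF b0c] by blast
  have vc: "v \<in> carrier G" by (rule center_closed[OF v(1)])
  define b where "b = b0 \<otimes> v"
  have bc: "b \<in> carrier G" using b0c(1) vc by (simp add: b_def)
  have bL: "b \<bowtie> l" if l: "l \<in> L" for l
    unfolding b_def
    by (rule commute_mult[OF b0c(1) vc L.mem_carrier[OF l] bspec[OF b0(3) l] center_commute[OF v(1) L.mem_carrier[OF l]]])
  have "b \<notin> center G"
  proof
    assume "b \<in> center G"
    then have "b \<otimes> inv v \<in> center G"
      using v(1) center_subgroup by (blast intro: subgroup.m_closed subgroup.m_inv_closed)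
    then show False using b0(2) b0c(1) vc by (simp add: b_def m_assoc)
  qed
  then have "\<not> b \<bowtie> w" using all[OF bc bL] by blast
  then show ?thesis using that[OF bc v(2)[folded b_def]] bL unfolding L_def by blast
qed

text \<open>On the complement of w and b all squares are even: otherwise uw would have an even
  square and commute with b, and since u does, so would w. The complement thus splits into the
  center and dihedral factors, and the center is absorbed by the subgroup generated by w and
  b.\<close>

lemma decomposition_odd:
  assumes k2: "k \<ge> 2" and w: "w \<in> carrier G" "\<not> even_square w"
  shows "\<exists>e. central_decomposition G (Q_group (k + 1) 1 # replicate e (Q_group 1 1)) \<and>
    (all_centralizers_abelian \<longrightarrow> e = 0)"
proof -
  obtain b where b: "b \<in> carrier G" "b \<otimes> b = \<one>" "\<not> b \<bowtie> w"
    and even_b: "\<And>x. x \<in> carrier G \<Longrightarrow> even_square x \<Longrightarrow> b \<bowtie> x"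
    using odd_square_dual[OF k2 w] by metis
  have nc: "\<not> w \<bowtie> b" using b(3) by metis
  let ?S = "perp (carrier G) w b" and ?K = "range (word_value G (case_ab w b))"
  note K = range_word_value_pair[OF subgroup_self w(1) b(1)]
  have N: "nondegenerate ?S" by (rule perp_nondegenerate[OF nondegenerate_carrier w(1) b(1) nc])
  have even: "even_square u" if "u \<in> ?S" for u
  proof (rule ccontr)
    have u: "u \<in> carrier G" "u \<bowtie> b" using that unfolding perp_def by blast+
    assume "\<not> even_square u"
    then have "even_square (u \<otimes> w)" using even_square_mult[OF k2 u(1) w(1)] w(2) by simp
    then have "b \<bowtie> u \<otimes> w" using even_b u w by simp
    then have "w \<bowtie> b" by (rule commute_cancel_left[OF u(1) w(1) b(1) u(2) HOL.sym])
    then show False using nc by blast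
  qed
  have "\<exists>T F e. dihedral_splitting ?S T F e"
  proof (rule split_dihedral[OF N])
    fix u assume u: "u \<in> ?S"
    then have "u \<in> carrier G" unfolding perp_def by blast
    then show "\<exists>v \<in> center G. (u \<otimes> v) \<otimes> (u \<otimes> v) \<in> {\<one>, c}"
      using even_square_adjust even[OF u] by blast
  qed
  then obtain T F e where "dihedral_splitting ?S T F e" by blast
  note D = dihedral_splittingD[OF this]
  have T: "T = center G" by (rule even_square_subset_center[OF D(1,7)]) (use even D(4) in blast)
  obtain j :: int where j: "w \<otimes> w = z [^] j" "odd j" using odd_square[OF w] by blast
  have "z \<in> ?K"
  proof -
    \<comment> \<open>The exponent a inverts j modulo 2^k, so that (w^2)^a = z.\<close>
    have "coprime j (2 ^ k)" using j(2) by simp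
    then obtain a d where ad: "a * j + d * 2 ^ k = 1" using bezout_int[of j "2 ^ k"] by auto
    have "w \<otimes> w \<in> ?K" using K(1,3) by (rule subgroup.m_closed[OF _ _ K(3)])
    then have "(z [^] j) [^] a \<in> ?K" unfolding j(1) by (rule subgroup_int_pow_closed[OF K(1)])
    moreover have "j * a - 1 = 2 ^ k * (- d)" using ad by (simp add: algebra_simps)
    then have "z [^] (j * a) = z [^] (1 :: int)" unfolding pow_z_eq by (metis dvd_triv_left)
    then have "(z [^] j) [^] a = z" using z by (simp add: int_pow_pow)
    ultimately show ?thesis by simp
  qed
  then have ZK: "center G \<subseteq> ?K" unfolding center_eq using subgroup_int_pow_closed[OF K(1)] by blast
  have comm: "x \<bowtie> f" if "x \<in> ?K" "f \<in> F" for x f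
    by (rule K(5)[OF that(1) subsetD[OF D(5) that(2)]])
  have "?K <#> F = carrier G"
  proof
    show "?K <#> F \<subseteq> carrier G" using K(2) D(5) unfolding set_mult_def perp_def by blast
    show "carrier G \<subseteq> ?K <#> F"
    proof
      fix p assume "p \<in> carrier G"
      then obtain d q where dq: "d \<in> ?K" "q \<in> ?S" "p = d \<otimes> q"
        using perp_decompose[OF subgroup_self w(1) b(1) nc _ K(1,3,4)] by blast
      then obtain t f where tf: "t \<in> T" "f \<in> F" "q = t \<otimes> f" using D(3) unfolding set_mult_def by blast
      have car: "d \<in> carrier G" "t \<in> carrier G" "f \<in> carrier G"
        using dq(1) tf(1,2) K(2) D(4,5) unfolding perp_def by blast+
      have "d \<otimes> t \<in> ?K" using subgroup.m_closed[OF K(1) dq(1)] tf(1) T ZK by blast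
      moreover have "p = d \<otimes> t \<otimes> f" using dq tf car by (simp add: m_assoc)
      ultimately show "p \<in> ?K <#> F" using tf(2) unfolding set_mult_def by blast
    qed
  qed
  moreover have "G\<lparr>carrier := ?K\<rparr> \<cong> Q_group (k + 1) 1"
  proof (rule Q_n_1_iso[OF w(1) b(1)])
    \<comment> \<open>As j is odd, z^(j 2^(k-1)) is the involution c, which is also the commutator
      of w and b.\<close>
    have "w [^] (2 ^ k :: nat) = (w \<otimes> w) [^] (2 ^ (k - 1) :: nat)"
      using w(1) k by (cases k) (simp_all add: nat_pow_pow flip: pow_two)
    also have "\<dots> = z [^] (j * 2 ^ (k - 1))"
      using int_pow_int[of G "z [^] j" "2 ^ (k - 1)"] z by (simp add: j(1) int_pow_pow)
    also have "\<dots> = c"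
    proof -
      obtain l where "j = 2 * l + 1" using j(2) by (rule oddE)
      then have "j * 2 ^ (k - 1) - 2 ^ (k - 1) = 2 ^ k * l" by (simp add: two_pow_k algebra_simps)
      then show ?thesis unfolding c_def pow_z_eq by simp
    qed
    finally have wk: "w [^] (2 ^ k :: nat) = c" .
    then show "w \<otimes> b = b \<otimes> w \<otimes> w [^] (2 ^ (k + 1 - 1) :: nat)"
      using non_commute[OF b(1) w(1) b(3)] by simp
    have "w [^] (2 ^ k * 2 :: nat) = \<one>"
      using wk w(1) c_involution by (simp add: pow_two flip: nat_pow_pow)
    then have "ord w dvd 2 ^ (k + 1)" using w(1) by (simp add: pow_eq_id mult.commute)
    then obtain i where i: "i \<le> k + 1" "ord w = 2 ^ i"
      using divides_primepow_nat[OF two_is_prime_nat] by blast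
    have "\<not> ord w dvd 2 ^ k" using wk c_ne w(1) by (simp flip: pow_eq_id)
    then have "i = k + 1" using i le_imp_power_dvd[of i k "2::nat"] by (metis le_Suc_eq Suc_eq_plus1)
    then show "ord w = 2 ^ (k + 1)" using i by simp
  qed (use k2 b in auto)
  ultimately have "central_decomposition G (Q_group (k + 1) 1 # replicate e (Q_group 1 1))"
    by (intro central_decomposition_mult[OF K(1) comm D(2)])
  moreover have "e = 0" if CA: all_centralizers_abelian
    by (rule dihedral_product_not_central[OF D(2) order_trans[OF D(5) perp_central[OF CA nondegenerate_carrier w(1) b(1) nc]]])
  ultimately show ?thesis by blast
qed

text \<open>The number \<open>n\<close> is k or k + 1 with k at least 2, which explains the bounds n
  > 1 and n > 2.\<close>

theorem two_group_decomposition: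
  assumes nonab: "\<not> carrier G \<subseteq> center G"
  shows "(\<exists>n e. e \<ge> 1 \<and> n > 1 \<and> central_decomposition G (Q_group n 0 # replicate e (Q_group 1 1)) \<and>
        (all_centralizers_abelian \<longrightarrow> e = 1)) \<or>
    (\<exists>n e. n > 2 \<and> central_decomposition G (Q_group n 1 # replicate e (Q_group 1 1)) \<and>
        (all_centralizers_abelian \<longrightarrow> e = 0)) \<or>
    (\<exists>e \<ge> 1. central_decomposition G (replicate e (Q_group 1 1)) \<and>
        (all_centralizers_abelian \<longrightarrow> e = 1)) \<or>
    (\<exists>e. central_decomposition G (R_group 1 # replicate e (Q_group 1 1)) \<and>
        (all_centralizers_abelian \<longrightarrow> e = 0))"
proof (cases "k = 1")
  case True
  then show ?thesis using decomposition_k1[OF True nonab] by blast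
next
  case False
  then have k2: "k \<ge> 2" using k by simp
  show ?thesis
  proof (cases "\<forall>x \<in> carrier G. even_square x")
    case True
    then obtain e where "e \<ge> 1" "central_decomposition G (Q_group k 0 # replicate e (Q_group 1 1))"
      "all_centralizers_abelian \<longrightarrow> e = 1"
      using decomposition_even[OF k2 nonab] by blast
    moreover have "k > 1" using k2 by simp
    ultimately show ?thesis by blast
  next
    case False
    then obtain w where "w \<in> carrier G" "\<not> even_square w" by blast
    moreover have "k + 1 > 2" using k2 by simp
    ultimately show ?thesis using decomposition_odd[OF k2] by blast
  qed
qed

end

subsection \<open>Splitting off the odd part of the center\<close>

context group
begin

lemma centralizer_cong_center:
  assumes x: "x \<in> carrier G" and u: "u \<in> center G"
  shows "centralizer G (u \<otimes> x) = centralizer G x"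
proof -
  have uc: "u \<in> carrier G" using u by (rule center_closed)
  have "h \<otimes> (u \<otimes> x) = (u \<otimes> x) \<otimes> h \<longleftrightarrow> h \<otimes> x = x \<otimes> h" if h: "h \<in> carrier G" for h
    using commute_mult[OF uc x h center_commute[OF u h]]
      commute_cancel_left[OF uc x h center_commute[OF u h]] by metis
  then show ?thesis unfolding centralizer_def by blast
qed

lemma centralizer_inv:
  assumes x: "x \<in> carrier G"
  shows "centralizer G (inv x) = centralizer G x"
proof -
  have "h \<otimes> inv x = inv x \<otimes> h \<longleftrightarrow> h \<otimes> x = x \<otimes> h" if h: "h \<in> carrier G" for h
    using commutes_inv[OF x h] commutes_inv[OF inv_closed[OF x] h] x by (metis inv_inv)
  then show ?thesis unfolding centralizer_def by blast
qed

lemma square_central_if_n_centralizer: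
  assumes fin: "finite (carrier G)" and n: "n_centralizer (order G div card (center G)) G"
    and x: "x \<in> carrier G"
  shows "x \<otimes> x \<in> center G"
proof -
  let ?Z = "center G"
  have Z: "subgroup ?Z G" by (rule center_subgroup)
  interpret Z: subgroup ?Z G by (rule Z)
  \<comment> \<open>Sends a coset of the center to the common centralizer of its elements, through a
    chosen representative.\<close>
  define \<phi> where "\<phi> C = centralizer G (SOME y. y \<in> C)" for C
  have \<phi>: "\<phi> (?Z #> y) = centralizer G y" if y: "y \<in> carrier G" for y
  proof -
    have "y \<in> ?Z #> y" using rcos_self[OF y Z] .
    then have "(SOME w. w \<in> ?Z #> y) \<in> ?Z #> y" by (rule someI)
    then obtain u where "u \<in> ?Z" "(SOME w. w \<in> ?Z #> y) = u \<otimes> y" unfolding r_coset_def by blast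
    then show ?thesis using centralizer_cong_center[OF y] by (simp add: \<phi>_def)
  qed
  have "\<phi> ` (rcosets ?Z) = Cent G"
    unfolding Cent_def RCOSETS_def using \<phi> by (auto simp: image_iff)
  moreover have "card (rcosets ?Z) * card ?Z = order G"
    using lagrange[OF Z] by simp
  then have "card (rcosets ?Z) = order G div card ?Z"
    using Z.finite_imp_card_positive[OF fin] by (metis nonzero_mult_div_cancel_right less_numeral_extra(3))
  moreover have "finite (rcosets ?Z)" using fin by (simp add: RCOSETS_def)
  \<comment> \<open>A map from a finite set onto a set of the same size is injective.\<close>
  ultimately have inj: "inj_on \<phi> (rcosets ?Z)"
    using n by (intro eq_card_imp_inj_on) (auto simp: n_centralizer_def)
  have "\<phi> (?Z #> x) = \<phi> (?Z #> inv x)"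
    using x by (simp add: \<phi> centralizer_inv)
  then have "?Z #> x = ?Z #> inv x"
    by (rule inj_onD[OF inj _ rcosetsI rcosetsI]) (use x Z.subset in auto)
  then have "x \<in> ?Z #> inv x" using rcos_self[OF x Z] by simp
  then obtain u where u: "u \<in> ?Z" "x = u \<otimes> inv x" unfolding r_coset_def by blast
  then have "x \<otimes> x = u \<otimes> inv x \<otimes> x" by simp
  also have "\<dots> = u" using u(1) x center_closed by (simp add: m_assoc)
  finally show ?thesis using u(1) by simp
qed

lemma int_pow_subgroup:
  assumes "a \<in> carrier G"
  shows "subgroup (range (\<lambda>i::int. a [^] i)) G"
proof -
  have "range (\<lambda>i::int. a [^] i) = generate G {a}"
    using generate_pow[OF assms] by auto
  then show ?thesis using generate_is_subgroup[of "{a}"] assms by simp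
qed

lemma ord_subgroup:
  assumes H: "subgroup H G" and x: "x \<in> H"
  shows "group.ord (G\<lparr>carrier := H\<rparr>) x = ord x"
proof -
  interpret H: group "G\<lparr>carrier := H\<rparr>" by (rule subgroup_imp_group[OF H])
  have xc: "x \<in> carrier G" using H x by (rule subgroup.mem_carrier)
  have "H.ord x dvd n \<longleftrightarrow> ord x dvd n" for n
    using H.pow_eq_id[of x n] pow_eq_id[OF xc, of n] x by (simp flip: nat_pow_consistent)
  then show ?thesis by (metis dvd_antisym dvd_refl)
qed

lemma cyclic_subgroup_iff:
  assumes H: "subgroup H G"
  shows "cyclic_group (G\<lparr>carrier := H\<rparr>) \<longleftrightarrow> (\<exists>x \<in> H. H = range (\<lambda>i::int. x [^] i))"
proof -
  interpret H: group "G\<lparr>carrier := H\<rparr>" by (rule subgroup_imp_group[OF H])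
  show ?thesis unfolding H.cyclic_group by (simp add: int_pow_consistent[OF H])
qed

lemma int_pow_integer_mod_group_iso:
  assumes a: "a \<in> carrier G" and t: "ord a = t" "t > 0"
  shows "G\<lparr>carrier := range (\<lambda>i::int. a [^] i)\<rparr> \<cong> integer_mod_group t"
proof -
  let ?A = "range (\<lambda>i::int. a [^] i)"
  have eq: "a [^] i = a [^] j \<longleftrightarrow> i mod int t = j mod int t" for i j :: int
    using int_pow_eq[OF a] t(1) by (metis mod_eq_dvd_iff)
  have "(\<lambda>i. a [^] i) \<in> iso (integer_mod_group t) (G\<lparr>carrier := ?A\<rparr>)"
  proof (rule isoI)
    show "(\<lambda>i. a [^] i) \<in> hom (integer_mod_group t) (G\<lparr>carrier := ?A\<rparr>)"
    proof (rule homI)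
      fix i j :: int
      have "a [^] ((i + j) mod int t) = a [^] (i + j)" unfolding eq by simp
      then show "a [^] (i \<otimes>\<^bsub>integer_mod_group t\<^esub> j) = a [^] i \<otimes>\<^bsub>G\<lparr>carrier := ?A\<rparr>\<^esub> a [^] j"
        using a by (simp add: int_pow_mult)
    qed simp
    show "bij_betw (\<lambda>i. a [^] i) (carrier (integer_mod_group t)) (carrier (G\<lparr>carrier := ?A\<rparr>))"
      unfolding bij_betw_def
    proof
      show "inj_on (\<lambda>i. a [^] i) (carrier (integer_mod_group t))"
        using t(2) by (auto simp: inj_on_def eq carrier_integer_mod_group)
      have "a [^] i \<in> (\<lambda>i. a [^] i) ` {0..<int t}" for i :: int
      proof
        show "a [^] i = a [^] (i mod int t)" unfolding eq by simp
      qed (use t(2) in simp)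
      then show "(\<lambda>i. a [^] i) ` carrier (integer_mod_group t) = carrier (G\<lparr>carrier := ?A\<rparr>)"
        using t(2) by (auto simp: carrier_integer_mod_group)
    qed
  qed
  then have "integer_mod_group t \<cong> G\<lparr>carrier := ?A\<rparr>" unfolding is_iso_def by blast
  then show ?thesis by (rule group.iso_sym[OF group_integer_mod_group])
qed

text \<open>An odd prime q dividing the order would yield a nontrivial element whose order divides
  both q and 2^N.\<close>

lemma two_group_if_exponent:
  assumes fin: "finite (carrier G)" and e: "\<And>x. x \<in> carrier G \<Longrightarrow> x [^] (2 ^ N :: nat) = \<one>"
  shows "two_group G"
proof -
  have pos: "order G > 0" using fin order_gt_0_iff_finite by blast
  have "\<not> is_unit (2::nat)" by simp
  then obtain r where r: "order G = 2 ^ multiplicity 2 (order G) * r" "\<not> 2 dvd r"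
    using multiplicity_decompose'[of "order G" 2] pos by auto
  have "r = 1"
  proof (rule ccontr)
    assume "r \<noteq> 1"
    then obtain q where q: "Factorial_Ring.prime q" "q dvd r" using prime_factor_nat by blast
    then have "q \<noteq> 2" using r by blast
    \<comment> \<open>With exponent 1, Sylow's theorem serves as Cauchy's theorem; q may still
      divide m.\<close>
    obtain m where "order G = q ^ 1 * m" using q(2) r(1) by (metis dvdE dvd_mult power_one_right)
    then obtain H where H: "subgroup H G" "card H = q"
      using sylow_thm[OF q(1) is_group _ fin, of 1 m] by (metis power_one_right)
    interpret H: group "G\<lparr>carrier := H\<rparr>" by (rule subgroup_imp_group[OF H(1)])
    have "card H > 1" using H(2) q(1) prime_gt_1_nat by simp
    then have "H \<noteq> {\<one>}" by auto
    then obtain h where h: "h \<in> H" "h \<noteq> \<one>" using subgroup.one_closed[OF H(1)] by blast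
    have hc: "h \<in> carrier G" using H(1) h(1) by (rule subgroup.mem_carrier)
    have "h [^] q = \<one>"
      using H.pow_order_eq_1[of h] h(1) H(2) by (simp add: order_def flip: nat_pow_consistent)
    then have "ord h dvd q" using hc by (simp add: pow_eq_id)
    moreover have "ord h dvd 2 ^ N" using e[OF hc] hc by (simp add: pow_eq_id)
    moreover have "coprime q (2 ^ N)" using primes_coprime[OF q(1) two_is_prime_nat \<open>q \<noteq> 2\<close>] by simp
    ultimately have "ord h = 1" by (metis coprime_common_divisor_nat)
    then show False using h(2) hc ord_eq_1[of h] by simp
  qed
  then show ?thesis using r(1) is_group by (auto simp: two_group_def)
qed

end

section \<open>The direct decomposition of G into A and P\<close>

locale cyclic_center_squares = central_squares +
  fixes g k t
  assumes fin: "finite (carrier G)" and g: "g \<in> carrier G"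
    and center_eq: "center G = range (\<lambda>i::int. g [^] i)"
    and ord_g: "ord g = 2 ^ k * t" and t: "odd t"
    and nonab: "\<not> carrier G \<subseteq> center G"
begin

lemma pow_g_eq: "g [^] (i::int) = g [^] (j::int) \<longleftrightarrow> 2 ^ k * int t dvd i - j"
  using int_pow_eq[OF g, of i j] by (simp add: ord_g dvd_diff_commute)

text \<open>A center of odd order contains no involution, so all commutators would be
  trivial.\<close>

lemma k_pos: "k \<ge> 1"
proof (rule ccontr)
  assume "\<not> k \<ge> 1"
  then have k: "k = 0" by simp
  have "x \<in> center G" if x: "x \<in> carrier G" for x
  proof (rule centerI[OF x])
    fix y assume y: "y \<in> carrier G"
    obtain d where d: "d \<in> center G" "d \<otimes> d = \<one>" "y \<otimes> x = x \<otimes> y \<otimes> d"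
      using commutator_central_involution[OF x y] by blast
    obtain i :: int where i: "d = g [^] i" using d(1) center_eq by blast
    have "g [^] (i + i) = g [^] (0::int)" using d(2) g unfolding i by (simp only: int_pow_mult int_pow_0)
    then have "int t dvd 2 * i" unfolding pow_g_eq k by simp
    moreover have "coprime (int t) 2" using t by simp
    ultimately have "int t dvd i" by (simp add: coprime_dvd_mult_right_iff)
    then have "g [^] i = g [^] (0::int)" unfolding pow_g_eq k by simp
    then have "d = \<one>" by (simp add: i)
    then show "x \<otimes> y = y \<otimes> x" using d(3) x y by simp
  qed
  then show False using nonab by blast
qed

text \<open>One squaring leads into the center, and the remaining exponent 2^k kills the 2-part of
  the center; all values therefore lie in its odd part.\<close>

definition twopow where "twopow x = x [^] (2 ^ (k + 1) :: nat)"

lemma twopow_eq: "x \<in> carrier G \<Longrightarrow> twopow x = (x \<otimes> x \<otimes> (x \<otimes> x)) [^] (2 ^ (k - 1) :: nat)"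
proof -
  assume x: "x \<in> carrier G"
  have "(2::nat) ^ (k + 1) = 2 * (2 * 2 ^ (k - 1))" using k_pos by (cases k) auto
  then show ?thesis using x by (simp add: twopow_def nat_pow_pow flip: pow_two)
qed

text \<open>The fourth power is already multiplicative: (xy)^2 = x^2 y^2 d, and squaring once more
  removes d. The exponent 2^(k+1) is a multiple of 4 because k is positive, and the remaining power
  is taken of commuting elements.\<close>

lemma twopow_mult:
  assumes x: "x \<in> carrier G" and y: "y \<in> carrier G"
  shows "twopow (x \<otimes> y) = twopow x \<otimes> twopow y"
proof -
  have xx: "x \<otimes> x \<in> center G" and yy: "y \<otimes> y \<in> center G"
    using square_central x y by blast+
  have xxc: "x \<otimes> x \<in> carrier G" and yyc: "y \<otimes> y \<in> carrier G" using x y by simp_all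
  obtain d where d: "d \<in> center G" "d \<otimes> d = \<one>" "y \<otimes> x = x \<otimes> y \<otimes> d"
    using commutator_central_involution[OF x y] by blast
  have dc: "d \<in> carrier G" by (rule center_closed[OF d(1)])
  have "(x \<otimes> y) \<otimes> (x \<otimes> y) = x \<otimes> (y \<otimes> x) \<otimes> y" using x y by (simp add: m_assoc)
  also have "\<dots> = x \<otimes> (x \<otimes> y \<otimes> d) \<otimes> y" by (simp only: d(3))
  also have "\<dots> = x \<otimes> x \<otimes> y \<otimes> (d \<otimes> y)" using x y dc by (simp add: m_assoc)
  also have "d \<otimes> y = y \<otimes> d" by (rule center_commute[OF d(1) y])
  also have "x \<otimes> x \<otimes> y \<otimes> (y \<otimes> d) = (x \<otimes> x) \<otimes> (y \<otimes> y) \<otimes> d" using x y dc by (simp add: m_assoc)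
  finally have 1: "(x \<otimes> y) \<otimes> (x \<otimes> y) = (x \<otimes> x) \<otimes> (y \<otimes> y) \<otimes> d" .
  let ?p = "x \<otimes> x" and ?q = "y \<otimes> y"
  have 2: "?p \<otimes> ?q \<otimes> d \<otimes> (?p \<otimes> ?q \<otimes> d) = ?p \<otimes> ?p \<otimes> (?q \<otimes> ?q)"
  proof -
    have "?p \<otimes> ?q \<otimes> d \<otimes> (?p \<otimes> ?q \<otimes> d) = ?p \<otimes> ?q \<otimes> (d \<otimes> (?p \<otimes> ?q)) \<otimes> d"
      using xxc yyc dc by (simp only: m_assoc m_closed)
    also have "d \<otimes> (?p \<otimes> ?q) = ?p \<otimes> ?q \<otimes> d" by (rule center_commute[OF d(1)]) (use xxc yyc in simp)
    also have "?p \<otimes> ?q \<otimes> (?p \<otimes> ?q \<otimes> d) \<otimes> d = ?p \<otimes> (?q \<otimes> ?p) \<otimes> ?q \<otimes> (d \<otimes> d)"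
      using xxc yyc dc by (simp only: m_assoc m_closed)
    also have "?q \<otimes> ?p = ?p \<otimes> ?q" by (rule center_commute[OF yy xxc])
    also have "?p \<otimes> (?p \<otimes> ?q) \<otimes> ?q \<otimes> (d \<otimes> d) = ?p \<otimes> ?p \<otimes> (?q \<otimes> ?q)"
      unfolding d(2) using xxc yyc by (simp only: m_assoc m_closed r_one)
    finally show ?thesis .
  qed
  have "?p \<otimes> ?p \<otimes> (?q \<otimes> ?q) = ?q \<otimes> ?q \<otimes> (?p \<otimes> ?p)"
    by (rule center_commute[OF subgroup.m_closed[OF center_subgroup xx xx]]) (use yyc in simp)
  then have "(?p \<otimes> ?p \<otimes> (?q \<otimes> ?q)) [^] (2 ^ (k - 1) :: nat) = twopow x \<otimes> twopow y"
    unfolding twopow_eq[OF x] twopow_eq[OF y] using xxc yyc by (intro pow_mult_distrib) simp_all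
  then show ?thesis
    unfolding twopow_eq[OF m_closed[OF x y]] 1 2 .
qed

lemma twopow_closed: "x \<in> carrier G \<Longrightarrow> twopow x \<in> carrier G"
  by (simp add: twopow_def)

lemma twopow_one: "twopow \<one> = \<one>"
  by (simp add: twopow_def)

lemma twopow_inv: "x \<in> carrier G \<Longrightarrow> twopow (inv x) = inv (twopow x)"
  by (simp add: twopow_def nat_pow_inv)

definition P where "P = {x \<in> carrier G. twopow x = \<one>}"

text \<open>Generator of the subgroup of odd order t in the center.\<close>

definition a where "a = g [^] (2 ^ k :: int)"

definition A where "A = range (\<lambda>i::int. a [^] i)"

lemma P_subgroup: "subgroup P G"
proof (rule subgroupI)
  have "\<one> \<in> P" by (simp add: P_def twopow_one)
  then show "P \<noteq> {}" by blast
qed (auto simp: P_def twopow_inv twopow_mult)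

lemma P_normal: "P \<lhd> G"
  unfolding normal_inv_iff
proof (intro conjI ballI)
  fix x h assume x: "x \<in> carrier G" and h: "h \<in> P"
  then show "x \<otimes> h \<otimes> inv x \<in> P"
    by (simp add: P_def twopow_mult twopow_inv twopow_closed)
qed (rule P_subgroup)

lemma a_closed [simp]: "a \<in> carrier G"
  using g by (simp add: a_def)

lemma a_pow: "a [^] (i::int) = g [^] (2 ^ k * i)"
  using g by (simp add: a_def int_pow_pow)

lemma ord_a: "ord a = t"
proof -
  have "a = g [^] (2 ^ k :: nat)" by (simp add: a_def flip: int_pow_int)
  moreover have "ord (g [^] (2 ^ k :: nat)) = t" using g by (subst ord_pow) (simp_all add: ord_g)
  ultimately show ?thesis by simp
qed

lemma A_center: "A \<subseteq> center G"
  unfolding A_def center_eq a_pow by blast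

lemma A_normal: "A \<lhd> G"
  unfolding normal_inv_iff
proof (intro conjI ballI)
  show "subgroup A G" unfolding A_def by (rule int_pow_subgroup) simp
  fix x h assume x: "x \<in> carrier G" and h: "h \<in> A"
  have hc: "h \<in> carrier G" using h A_center center_closed by blast
  have "x \<otimes> h = h \<otimes> x" using center_commute[OF subsetD[OF A_center h] x] by (rule HOL.sym)
  then have "x \<otimes> h \<otimes> inv x = h" using x hc by (simp add: m_assoc)
  then show "x \<otimes> h \<otimes> inv x \<in> A" using h by simp
qed

lemma twopow_a: "twopow (a [^] (i::int)) = a [^] (i * 2 ^ (k + 1))"
proof -
  have "twopow (a [^] i) = (a [^] i) [^] (2 ^ (k + 1) :: int)"
    unfolding twopow_def by (simp flip: int_pow_int)
  then show ?thesis by (simp add: int_pow_pow)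
qed

lemma a_pow_eq: "a [^] (i::int) = a [^] (j::int) \<longleftrightarrow> int t dvd i - j"
  using int_pow_eq[of a i j] by (simp add: ord_a dvd_diff_commute)

text \<open>On A, of odd order t, raising to a power of two is injective.\<close>

lemma A_Int_P: "A \<inter> P = {\<one>}"
proof
  show "A \<inter> P \<subseteq> {\<one>}"
  proof
    fix x assume x: "x \<in> A \<inter> P"
    then obtain i :: int where i: "x = a [^] i" unfolding A_def by blast
    have "a [^] (i * 2 ^ (k + 1)) = a [^] (0::int)" using x unfolding P_def i by (simp add: twopow_a)
    then have "int t dvd i * 2 ^ (k + 1)" unfolding a_pow_eq by simp
    moreover have "coprime (int t) (2 ^ (k + 1))" using t by simp
    ultimately have "int t dvd i" using coprime_dvd_mult_left_iff by blast
    then have "a [^] i = a [^] (0::int)" unfolding a_pow_eq by simp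
    then show "x \<in> {\<one>}" by (simp add: i)
  qed
  have "a [^] (0::int) \<in> A" unfolding A_def by blast
  then show "{\<one>} \<subseteq> A \<inter> P" by (simp add: P_def twopow_one)
qed

text \<open>The value \<open>twopow x\<close> lies in A, and on A the map is bijective as t is odd.
  So some b in A has the same value as x, and b^-1 x lies in the kernel P.\<close>

lemma A_mult_P: "A <#> P = carrier G"
proof
  show "A <#> P \<subseteq> carrier G" using A_center center_closed unfolding P_def set_mult_def by blast
  show "carrier G \<subseteq> A <#> P"
  proof
    fix x assume x: "x \<in> carrier G"
    obtain i :: int where i: "x \<otimes> x = g [^] i" using square_central[OF x] center_eq by blast
    have "twopow x = (x \<otimes> x) [^] (2 ^ k :: nat)"
      using x by (simp add: twopow_def flip: pow_two nat_pow_pow)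
    also have "\<dots> = g [^] (i * 2 ^ k)"
      using int_pow_int[of G "g [^] i" "2 ^ k"] g by (simp add: i int_pow_pow)
    finally have tx: "twopow x = a [^] i" by (simp add: a_pow mult.commute)
    \<comment> \<open>The coefficient u inverts 2^(k+1) modulo t, so a^(iu) is mapped to
      a^i.\<close>
    have "coprime (2 ^ (k + 1)) (int t)" using t by simp
    then obtain u v where uv: "u * 2 ^ (k + 1) + v * int t = 1"
      using bezout_int[of "2 ^ (k + 1)" "int t"] by auto
    define b where "b = a [^] (i * u)"
    have b: "b \<in> A" "b \<in> carrier G" by (auto simp: b_def A_def)
    have "i * u * 2 ^ (k + 1) - i = int t * (- i * v)"
      using arg_cong[OF uv, of "\<lambda>y. i * y"] by (simp add: algebra_simps)
    then have "twopow b = twopow x" unfolding b_def twopow_a tx a_pow_eq by (metis dvd_triv_left)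
    then have "inv b \<otimes> x \<in> P" using b x by (simp add: P_def twopow_mult twopow_inv twopow_closed)
    moreover have "x = b \<otimes> (inv b \<otimes> x)" using b x by (simp flip: m_assoc)
    ultimately show "x \<in> A <#> P" using b(1) unfolding set_mult_def by blast
  qed
qed

abbreviation GP where "GP \<equiv> G\<lparr>carrier := P\<rparr>"

text \<open>G is the product of P and the central subgroup A, so commuting with P means commuting
  with G.\<close>

lemma center_GP: "center GP = center G \<inter> P"
proof
  show "center G \<inter> P \<subseteq> center GP"
    using subgroup.subset[OF P_subgroup] unfolding center_def by auto
  show "center GP \<subseteq> center G \<inter> P"
  proof
    fix u assume u: "u \<in> center GP"
    then have uP: "u \<in> P" and comm: "\<And>p. p \<in> P \<Longrightarrow> u \<otimes> p = p \<otimes> u" unfolding center_def by auto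
    have uc: "u \<in> carrier G" by (rule subgroup.mem_carrier[OF P_subgroup uP])
    have "u \<in> center G"
    proof (rule centerI[OF uc])
      fix x assume "x \<in> carrier G"
      then obtain b p where bp: "b \<in> A" "p \<in> P" "x = b \<otimes> p" using A_mult_P unfolding set_mult_def by blast
      have bZ: "b \<in> center G" using bp(1) A_center by blast
      have "x \<otimes> u = u \<otimes> x"
        unfolding bp(3)
        by (rule commute_mult[OF center_closed[OF bZ] subgroup.mem_carrier[OF P_subgroup bp(2)] uc
              center_commute[OF bZ uc] comm[OF bp(2), symmetric]])
      then show "u \<otimes> x = x \<otimes> u" by (rule HOL.sym)
    qed
    then show "u \<in> center G \<inter> P" using uP by blast
  qed
qed

text \<open>Generator of the 2-part of the center of G, which is the center of P.\<close>

definition z where "z = g [^] (int t)"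

lemma z_pow: "z [^] (i::int) = g [^] (int t * i)"
  using g by (simp add: z_def int_pow_pow)

lemma twopow_g: "twopow (g [^] (i::int)) = g [^] (i * 2 ^ (k + 1))"
proof -
  have "twopow (g [^] i) = (g [^] i) [^] (2 ^ (k + 1) :: int)"
    unfolding twopow_def by (simp flip: int_pow_int)
  then show ?thesis using g by (simp add: int_pow_pow)
qed

lemma g_pow_in_P: "g [^] (i::int) \<in> P \<longleftrightarrow> int t dvd i"
proof -
  have "g [^] i \<in> P \<longleftrightarrow> g [^] (i * 2 ^ (k + 1)) = g [^] (0::int)" using g by (simp add: P_def twopow_g)
  also have "\<dots> \<longleftrightarrow> 2 ^ k * int t dvd 2 ^ k * (i * 2)" unfolding pow_g_eq by (simp add: algebra_simps)
  also have "\<dots> \<longleftrightarrow> int t dvd i * 2" by (simp del: mult.commute)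
  also have "\<dots> \<longleftrightarrow> int t dvd i" using t by (simp add: coprime_dvd_mult_left_iff)
  finally show ?thesis .
qed

lemma center_GP_eq: "center GP = range (\<lambda>i::int. z [^] i)"
proof -
  have "g [^] i \<in> P \<Longrightarrow> g [^] i \<in> range (\<lambda>i::int. z [^] i)" for i :: int
    unfolding g_pow_in_P z_pow by (auto elim!: dvdE)
  moreover have "z [^] i \<in> P" for i :: int unfolding z_pow g_pow_in_P by simp
  moreover have "z [^] i \<in> center G" for i :: int unfolding z_pow center_eq by blast
  ultimately show ?thesis unfolding center_GP by (auto simp: center_eq)
qed

lemma z_P: "z \<in> P" unfolding z_def g_pow_in_P by simp

lemma ord_z: "ord z = 2 ^ k"
proof -
  have "z = g [^] t" by (simp add: z_def int_pow_int)
  moreover have "ord (g [^] t) = 2 ^ k" using g t by (subst ord_pow) (auto simp add: ord_g elim: oddE)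
  ultimately show ?thesis by simp
qed

lemma P_cyclic_center_two_group: "cyclic_center_two_group GP z k"
proof -
  interpret P: group GP by (rule subgroup_imp_group[OF P_subgroup])
  show ?thesis
  proof
    fix x assume "x \<in> carrier GP"
    then have x: "x \<in> P" by simp
    have "x \<otimes> x \<in> center G" by (rule square_central[OF subgroup.mem_carrier[OF P_subgroup x]])
    moreover have "x \<otimes> x \<in> P" by (rule subgroup.m_closed[OF P_subgroup x x])
    ultimately show "x \<otimes>\<^bsub>GP\<^esub> x \<in> center GP" by (simp add: center_GP)
  next
    show "finite (carrier GP)" using fin by (simp add: P_def)
    show "z \<in> carrier GP" using z_P by simp
    show "center GP = range (\<lambda>i::int. z [^]\<^bsub>GP\<^esub> i)"
      unfolding center_GP_eq by (simp add: int_pow_consistent[OF P_subgroup z_P])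
    show "P.ord z = 2 ^ k" using ord_subgroup[OF P_subgroup z_P] ord_z by simp
    show "k \<ge> 1" by (rule k_pos)
  qed
qed

lemma P_two_group: "two_group GP"
proof -
  interpret P: group GP by (rule subgroup_imp_group[OF P_subgroup])
  show ?thesis
  proof (rule P.two_group_if_exponent)
    show "x [^]\<^bsub>GP\<^esub> (2 ^ (k + 1) :: nat) = \<one>\<^bsub>GP\<^esub>" if "x \<in> carrier GP" for x
      using that by (simp add: P_def twopow_def flip: nat_pow_consistent)
    show "finite (carrier GP)" using fin by (simp add: P_def)
  qed
qed

lemma P_cyclic_center: "cyclic_center GP"
proof -
  interpret P: cyclic_center_two_group GP z k by (rule P_cyclic_center_two_group)
  have "z \<in> center GP" using P.pow_z_center[of 1] P.z by simp
  then show ?thesis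
    unfolding cyclic_center_def P.cyclic_subgroup_iff[OF P.center_subgroup]
    using P.center_eq by blast
qed

lemma P_nonabelian: "\<not> carrier GP \<subseteq> center GP"
proof
  assume "carrier GP \<subseteq> center GP"
  then have "P \<subseteq> center G" by (simp add: center_GP)
  then have "A <#> P \<subseteq> center G"
    using A_center subgroup.m_closed[OF center_subgroup] unfolding set_mult_def by blast
  then show False using nonab by (simp add: A_mult_P)
qed

text \<open>An element of P outside the center of P is outside the center of G, so its centralizer
  in G is abelian.\<close>

lemma P_centralizers_abelian:
  assumes CA: "CA_group G"
  shows "cyclic_center_two_group.all_centralizers_abelian GP"
proof -
  interpret P: cyclic_center_two_group GP z k by (rule P_cyclic_center_two_group)
  have "u \<otimes> v = v \<otimes> u"
    if "x \<in> P" "x \<notin> center GP" "u \<in> P" "v \<in> P" "u \<otimes> x = x \<otimes> u" "v \<otimes> x = x \<otimes> v" for x u v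
  proof -
    have c: "y \<in> carrier G" if "y \<in> P" for y by (rule subgroup.mem_carrier[OF P_subgroup that])
    have "x \<in> carrier G - center G" using that(1,2) c by (simp add: center_GP)
    then interpret C: comm_group "G\<lparr>carrier := centralizer G x\<rparr>" using CA unfolding CA_group_def by blast
    show ?thesis using C.m_comm[of u v] that(3-6) c by (simp add: centralizer_def)
  qed
  note comm = this
  show ?thesis
    unfolding P.all_centralizers_abelian_def
  proof (intro ballI impI)
    fix x u v
    assume "x \<in> carrier GP - center GP" "u \<in> carrier GP" "v \<in> carrier GP"
      "u \<otimes>\<^bsub>GP\<^esub> x = x \<otimes>\<^bsub>GP\<^esub> u" "v \<otimes>\<^bsub>GP\<^esub> x = x \<otimes>\<^bsub>GP\<^esub> v"
    then show "u \<otimes>\<^bsub>GP\<^esub> v = v \<otimes>\<^bsub>GP\<^esub> u" using comm[of x u v] by simp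
  qed
qed

lemma A_iso: "G\<lparr>carrier := A\<rparr> \<cong> integer_mod_group t"
  unfolding A_def using t by (intro int_pow_integer_mod_group_iso ord_a) (auto elim: oddE)

lemma direct_product: "internal_direct_product G A P"
  unfolding internal_direct_product_def using A_normal P_normal A_Int_P A_mult_P by blast

end

theorem theorem4:
  fixes G :: "('a, 'b) monoid_scheme" (structure)
  assumes "group G" and "finite (carrier G)" and "\<not> comm_group G"
    and "cyclic_center G"
    and "n_centralizer (order G div card (center G)) G"
  shows "(\<exists>A P t. internal_direct_product G A P
            \<and> odd t \<and> G\<lparr>carrier := A\<rparr> \<cong> integer_mod_group t
            \<and> two_group (G\<lparr>carrier := P\<rparr>) \<and> cyclic_center (G\<lparr>carrier := P\<rparr>)
            \<and> ((\<exists>n \<epsilon>. \<epsilon> \<ge> 1 \<and> n > 1 \<and> central_decomposition (G\<lparr>carrier := P\<rparr>)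
                      (Q_group n 0 # replicate \<epsilon> (Q_group 1 1)))
              \<or> (\<exists>n \<epsilon>. \<epsilon> \<ge> 0 \<and> n > 2 \<and> central_decomposition (G\<lparr>carrier := P\<rparr>)
                      (Q_group n 1 # replicate \<epsilon> (Q_group 1 1)))
              \<or> (\<exists>\<epsilon>. \<epsilon> \<ge> 1 \<and> central_decomposition (G\<lparr>carrier := P\<rparr>)
                      (replicate \<epsilon> (Q_group 1 1)))
              \<or> (\<exists>\<epsilon>. \<epsilon> \<ge> 0 \<and> central_decomposition (G\<lparr>carrier := P\<rparr>)
                      (R_group 1 # replicate \<epsilon> (Q_group 1 1)))))
       \<and> (CA_group G \<longrightarrow>
           (\<exists>A P t. internal_direct_product G A P
            \<and> odd t \<and> G\<lparr>carrier := A\<rparr> \<cong> integer_mod_group t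
            \<and> two_group (G\<lparr>carrier := P\<rparr>) \<and> cyclic_center (G\<lparr>carrier := P\<rparr>)
            \<and> ((\<exists>n. n > 1 \<and> central_decomposition (G\<lparr>carrier := P\<rparr>) [Q_group n 0, Q_group 1 1])
              \<or> (\<exists>n. n > 2 \<and> central_decomposition (G\<lparr>carrier := P\<rparr>) [Q_group n 1])
              \<or> central_decomposition (G\<lparr>carrier := P\<rparr>) [Q_group 1 1]
              \<or> central_decomposition (G\<lparr>carrier := P\<rparr>) [R_group 1])))"
proof -
  interpret group G by fact
  interpret central_squares G
    by unfold_locales (rule square_central_if_n_centralizer[OF assms(2,5)])
  obtain g where g: "g \<in> center G" "center G = range (\<lambda>i::int. g [^] i)"
    using assms(4) unfolding cyclic_center_def cyclic_subgroup_iff[OF center_subgroup] by blast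
  have gc: "g \<in> carrier G" by (rule center_closed[OF g(1)])
  have "ord g \<noteq> 0" using ord_ge_1[OF assms(2) gc] by simp
  then obtain t where ord_g_eq: "ord g = 2 ^ multiplicity 2 (ord g) * t" "odd t"
    using multiplicity_decompose'[of "ord g" 2] by auto
  have nonab: "\<not> carrier G \<subseteq> center G"
  proof
    assume "carrier G \<subseteq> center G"
    then have "comm_group G" using center_commute by (intro group_comm_groupI) blast
    then show False using assms(3) by blast
  qed
  interpret cyclic_center_squares G g "multiplicity 2 (ord g)" t
    by unfold_locales (fact assms(2) gc g(2) ord_g_eq nonab)+
  interpret P: cyclic_center_two_group "G\<lparr>carrier := P\<rparr>" z "multiplicity 2 (ord g)"
    by (rule P_cyclic_center_two_group)
  note common = direct_product ord_g_eq(2) A_iso P_two_group P_cyclic_center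
  note decomposition = P.two_group_decomposition[OF P_nonabelian]
  let ?D = "central_decomposition (G\<lparr>carrier := P\<rparr>)"
  have "(\<exists>n \<epsilon>. \<epsilon> \<ge> 1 \<and> n > 1 \<and> ?D (Q_group n 0 # replicate \<epsilon> (Q_group 1 1)))
      \<or> (\<exists>n \<epsilon>. \<epsilon> \<ge> 0 \<and> n > 2 \<and> ?D (Q_group n 1 # replicate \<epsilon> (Q_group 1 1)))
      \<or> (\<exists>\<epsilon>. \<epsilon> \<ge> 1 \<and> ?D (replicate \<epsilon> (Q_group 1 1)))
      \<or> (\<exists>\<epsilon>. \<epsilon> \<ge> 0 \<and> ?D (R_group 1 # replicate \<epsilon> (Q_group 1 1)))"
    using decomposition by blast
  moreover have "(\<exists>n. n > 1 \<and> ?D [Q_group n 0, Q_group 1 1]) \<or> (\<exists>n. n > 2 \<and> ?D [Q_group n 1])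
      \<or> ?D [Q_group 1 1] \<or> ?D [R_group 1]" if "CA_group G"
  proof -
    \<comment> \<open>The CA conjuncts fix the number of dihedral factors at 1 or 0, which turns the
      replicated lists into explicit ones.\<close>
    have "P.all_centralizers_abelian" by (rule P_centralizers_abelian[OF that])
    with decomposition
    have "(\<exists>n. n > 1 \<and> ?D (Q_group n 0 # replicate 1 (Q_group 1 1)))
        \<or> (\<exists>n. n > 2 \<and> ?D (Q_group n 1 # replicate 0 (Q_group 1 1)))
        \<or> ?D (replicate 1 (Q_group 1 1)) \<or> ?D (R_group 1 # replicate 0 (Q_group 1 1))"
      by blast
    then show ?thesis by simp
  qed
  ultimately show ?thesis using common by blast
qed

end
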